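(* Let $N\ge 2$, let $q\in\Bbbk$ be a primitive $N$-th root of unity, and let $A$ be the Taft Hopf algebra with the bilinear form $\langle y,z\rangle=\lambda(zS(y))$. Let $a\in R$ be an invertible element, and let $s,m$ be integers with $0\le s,m\le N-1$. Then the left and right orthogonals of $N_{s,m}$ coincide, and likewise those of $aN_{s,m}$ (write $\perp$ for both), and $$N_{s,0}^{\perp}=\bigoplus_{\substack{0\le t\le N-1\\ t\not\equiv 1-s\ (\mathrm{mod}\ N)}}N_{t,0},\qquad N_{s,m}^{\perp}=N_{s,0}^{\perp}\oplus N_{1-s,N-m},\qquad (aN_{s,m})^{\perp}=S(a^{-1})N_{s,m}^{\perp}.$$
   Context: $\Bbbk$ is a field. The Taft algebra is $A=\Bbbk\langle g,x\mid g^N=1,\ x^N=0,\ gx=qxg\rangle$ with Hopf structure $\Delta(g)=g\otimes g$, $\Delta(x)=g\otimes x+x\otimes1$, and antipode $S$ with $S(g)=g^{-1}$, $S(x)=-g^{-1}x$. It has basis $\{x^ng^a\mid0\le n,a\le N-1\}$. For $t\in\mathbb{Z}$, $e_t:=\frac1N\sum_{i=0}^{N-1}q^{ti}g^i$ (depends only on $t$ mod $N$). $R$ is the subalgebra generated by $x$, and $N_{s,t}:=e_sx^tR$ for $s\in\mathbb{Z}$, $0\le t\le N$ (so $N_{s,N}=0$). $\lambda\in A^*$ is the left integral given by $\lambda(x^mg^b)=1$ if $m=N-1$ and $b\equiv1$ mod $N$, and $0$ otherwise ($m\in\mathbb{N},b\in\mathbb{Z}$). For a subspace $W$ of $A$,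 $W^{\perp_L}:=\{v\in A\mid\langle v,w\rangle=0\ \forall w\in W\}$ and $W^{\perp_R}:=\{v\in A\mid\langle w,v\rangle=0\ \forall w\in W\}$; $W^\perp$ is written when the two coincide. *)

theory Defs
  imports
    "HOL-Library.Poly_Mapping"
    "HOL-Number_Theory.Cong"
    "HOL-Algebra.Algebra"
    "HOL-Algebra.Algebraic_Closure_Type"
begin

section \<open>Algebras and Hopf algebras over a field\<close>

text \<open>An associative unital algebra over the field \<open>'k\<close> is a ring with a unit map
  \<open>\<iota>\<close> from \<open>'k\<close> to its centre; the scalar multiple \<open>c y\<close> is \<open>\<iota> c \<otimes> y\<close>.\<close>

locale k_algebra = ring A for A :: "('a, 'b) ring_scheme" (structure) +
  fixes \<iota> :: "'k::field \<Rightarrow> 'a"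
  assumes unit_closed: "\<iota> c \<in> carrier A"
    and unit_one: "\<iota> 1 = \<one>"
    and unit_add: "\<iota> (c + d) = \<iota> c \<oplus> \<iota> d"
    and unit_mult: "\<iota> (c * d) = \<iota> c \<otimes> \<iota> d"
    and unit_central: "y \<in> carrier A \<Longrightarrow> \<iota> c \<otimes> y = y \<otimes> \<iota> c"

definition bilinear_maps :: "('a, 'b) ring_scheme \<Rightarrow> ('k \<Rightarrow> 'a) \<Rightarrow> ('a \<Rightarrow> 'a \<Rightarrow> 'a) set" where
  "bilinear_maps A \<iota> = {\<beta>.
     (\<forall>u\<in>carrier A. \<forall>v\<in>carrier A. \<beta> u v \<in> carrier A) \<and>
     (\<forall>u\<in>carrier A. \<forall>u'\<in>carrier A. \<forall>v\<in>carrier A.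
        \<beta> (u \<oplus>\<^bsub>A\<^esub> u') v = \<beta> u v \<oplus>\<^bsub>A\<^esub> \<beta> u' v \<and> \<beta> v (u \<oplus>\<^bsub>A\<^esub> u') = \<beta> v u \<oplus>\<^bsub>A\<^esub> \<beta> v u') \<and>
     (\<forall>c. \<forall>u\<in>carrier A. \<forall>v\<in>carrier A.
        \<beta> (\<iota> c \<otimes>\<^bsub>A\<^esub> u) v = \<iota> c \<otimes>\<^bsub>A\<^esub> \<beta> u v \<and> \<beta> u (\<iota> c \<otimes>\<^bsub>A\<^esub> v) = \<iota> c \<otimes>\<^bsub>A\<^esub> \<beta> u v)}"

definition trilinear_maps ::
  "('a, 'b) ring_scheme \<Rightarrow> ('k \<Rightarrow> 'a) \<Rightarrow> ('a \<Rightarrow> 'a \<Rightarrow> 'a \<Rightarrow> 'a) set" where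
  "trilinear_maps A \<iota> = {\<gamma>. \<forall>w\<in>carrier A.
     (\<lambda>u v. \<gamma> u v w) \<in> bilinear_maps A \<iota> \<and> (\<lambda>u v. \<gamma> w u v) \<in> bilinear_maps A \<iota>}"

text \<open>Over a field and for \<open>A \<noteq> 0\<close>, an element of \<open>A \<otimes> A\<close> is determined by its values under
  the linear maps \<open>A \<otimes> A \<rightarrow> A\<close> induced by all bilinear maps \<open>A \<times> A \<rightarrow> A\<close>. It is therefore
  represented by the function sending a bilinear map \<open>\<beta>\<close> to that value: for a tensor
  \<open>T = \<Sum>i. u\<^sub>i \<otimes> v\<^sub>i\<close> the application \<open>T \<beta>\<close> is \<open>\<Sum>i. \<beta> u\<^sub>i v\<^sub>i\<close>.
  The product below is the one with \<open>(a \<otimes> b) (c \<otimes> d) = a c \<otimes> b d\<close>.\<close>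

definition pure_tensor ::
  "('a, 'b) ring_scheme \<Rightarrow> ('k \<Rightarrow> 'a) \<Rightarrow> 'a \<Rightarrow> 'a \<Rightarrow> (('a \<Rightarrow> 'a \<Rightarrow> 'a) \<Rightarrow> 'a)" where
  "pure_tensor A \<iota> u v = (\<lambda>\<beta>\<in>bilinear_maps A \<iota>. \<beta> u v)"

definition tensor_square ::
  "('a, 'b) ring_scheme \<Rightarrow> ('k \<Rightarrow> 'a) \<Rightarrow> (('a \<Rightarrow> 'a \<Rightarrow> 'a) \<Rightarrow> 'a) ring" where
  "tensor_square A \<iota> =
    \<lparr> carrier = {(\<lambda>\<beta>\<in>bilinear_maps A \<iota>. \<Oplus>\<^bsub>A\<^esub>i\<in>{..<n}. \<beta> (u i) (v i)) | (n::nat) u v.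
        u \<in> {..<n} \<rightarrow> carrier A \<and> v \<in> {..<n} \<rightarrow> carrier A},
      monoid.mult = (\<lambda>T U. \<lambda>\<beta>\<in>bilinear_maps A \<iota>. T (\<lambda>a b. U (\<lambda>c d. \<beta> (a \<otimes>\<^bsub>A\<^esub> c) (b \<otimes>\<^bsub>A\<^esub> d)))),
      monoid.one = pure_tensor A \<iota> \<one>\<^bsub>A\<^esub> \<one>\<^bsub>A\<^esub>,
      ring.zero = (\<lambda>\<beta>\<in>bilinear_maps A \<iota>. \<zero>\<^bsub>A\<^esub>),
      ring.add = (\<lambda>T U. \<lambda>\<beta>\<in>bilinear_maps A \<iota>. T \<beta> \<oplus>\<^bsub>A\<^esub> U \<beta>) \<rparr>"

locale hopf_algebra = k_algebra A \<iota>
  for A :: "('a, 'b) ring_scheme" (structure) and \<iota> :: "'k::field \<Rightarrow> 'a" +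
  fixes \<Delta> :: "'a \<Rightarrow> (('a \<Rightarrow> 'a \<Rightarrow> 'a) \<Rightarrow> 'a)" and \<epsilon> :: "'a \<Rightarrow> 'k" and S :: "'a \<Rightarrow> 'a"
  assumes comult_hom: "\<Delta> \<in> ring_hom A (tensor_square A \<iota>)"
    and comult_unit: "\<Delta> (\<iota> c) = pure_tensor A \<iota> (\<iota> c) \<one>"
    and counit_add: "\<lbrakk>y \<in> carrier A; z \<in> carrier A\<rbrakk> \<Longrightarrow> \<epsilon> (y \<oplus> z) = \<epsilon> y + \<epsilon> z"
    and counit_mult: "\<lbrakk>y \<in> carrier A; z \<in> carrier A\<rbrakk> \<Longrightarrow> \<epsilon> (y \<otimes> z) = \<epsilon> y * \<epsilon> z"
    and counit_unit: "\<epsilon> (\<iota> c) = c"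
    and coassoc: "\<lbrakk>h \<in> carrier A; \<gamma> \<in> trilinear_maps A \<iota>\<rbrakk> \<Longrightarrow>
        \<Delta> h (\<lambda>u v. \<Delta> u (\<lambda>a b. \<gamma> a b v)) = \<Delta> h (\<lambda>u v. \<Delta> v (\<lambda>b c. \<gamma> u b c))"
    and counit_left: "h \<in> carrier A \<Longrightarrow> \<Delta> h (\<lambda>u v. \<iota> (\<epsilon> u) \<otimes> v) = h"
    and counit_right: "h \<in> carrier A \<Longrightarrow> \<Delta> h (\<lambda>u v. u \<otimes> \<iota> (\<epsilon> v)) = h"
    and antipode_closed: "S \<in> carrier A \<rightarrow> carrier A"
    and antipode_add: "\<lbrakk>y \<in> carrier A; z \<in> carrier A\<rbrakk> \<Longrightarrow> S (y \<oplus> z) = S y \<oplus> S z"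
    and antipode_scale: "y \<in> carrier A \<Longrightarrow> S (\<iota> c \<otimes> y) = \<iota> c \<otimes> S y"
    and antipode_left: "h \<in> carrier A \<Longrightarrow> \<Delta> h (\<lambda>u v. S u \<otimes> v) = \<iota> (\<epsilon> h)"
    and antipode_right: "h \<in> carrier A \<Longrightarrow> \<Delta> h (\<lambda>u v. u \<otimes> S v) = \<iota> (\<epsilon> h)"


section \<open>The Taft algebra\<close>

definition primitive_root_of_unity :: "nat \<Rightarrow> 'k::field \<Rightarrow> bool" where
  "primitive_root_of_unity N q \<longleftrightarrow> N > 0 \<and> q ^ N = 1 \<and> (\<forall>k. 0 < k \<and> k < N \<longrightarrow> q ^ k \<noteq> 1)"

datatype taft_gen = Gen_g | Gen_x

text \<open>Words under concatenation form the free monoid, so that \<open>taft_gen list \<Rightarrow>\<^sub>0 'k\<close> with the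
  convolution product is the free algebra on the two generators.\<close>

instantiation list :: (type) monoid_add
begin
definition zero_list :: "'a list" where "zero_list = []"
definition plus_list :: "'a list \<Rightarrow> 'a list \<Rightarrow> 'a list" where "plus_list = (@)"
instance by standard (simp_all add: zero_list_def plus_list_def)
end

type_synonym 'k free_alg = "taft_gen list \<Rightarrow>\<^sub>0 'k"

definition free_g :: "'k::field free_alg" where "free_g = Poly_Mapping.single [Gen_g] 1"
definition free_x :: "'k::field free_alg" where "free_x = Poly_Mapping.single [Gen_x] 1"
definition free_const :: "'k::field \<Rightarrow> 'k free_alg" where "free_const c = Poly_Mapping.single [] c"

definition taft_ideal :: "nat \<Rightarrow> 'k::field \<Rightarrow> 'k free_alg set" where
  "taft_ideal N q = genideal ring_of_type_algebra
     {free_g ^ N - 1, free_x ^ N, free_g * free_x - free_const q * free_x * free_g}"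

definition taft_algebra :: "nat \<Rightarrow> 'k::field \<Rightarrow> 'k free_alg set ring" where
  "taft_algebra N q = ring_of_type_algebra Quot taft_ideal N q"

definition taft_class :: "nat \<Rightarrow> 'k::field \<Rightarrow> 'k free_alg \<Rightarrow> 'k free_alg set" where
  "taft_class N q f = taft_ideal N q +>\<^bsub>ring_of_type_algebra\<^esub> f"

definition taft_unit :: "nat \<Rightarrow> 'k::field \<Rightarrow> 'k \<Rightarrow> 'k free_alg set" where
  "taft_unit N q c = taft_class N q (free_const c)"

definition taft_g :: "nat \<Rightarrow> 'k::field \<Rightarrow> 'k free_alg set" where
  "taft_g N q = taft_class N q free_g"

definition taft_x :: "nat \<Rightarrow> 'k::field \<Rightarrow> 'k free_alg set" where
  "taft_x N q = taft_class N q free_x"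

lemma ring_ring_of_type: "ring (ring_of_type_algebra :: 'r::ring_1 ring)"
proof -
  have "\<exists>y. x + y = 0" for x :: 'r
    using add.right_inverse by blast
  thus ?thesis
    unfolding ring_of_type_algebra_def using add.right_inverse add.left_inverse
    by unfold_locales (auto simp: algebra_simps Units_def intro: exI[of _ "- _"])
qed

lemma ideal_taft_ideal: "ideal (taft_ideal N q) ring_of_type_algebra"
  unfolding taft_ideal_def
  by (rule ring.genideal_ideal[OF ring_ring_of_type]) (simp add: ring_of_type_algebra_def)

lemma taft_class_hom: "taft_class N q \<in> ring_hom ring_of_type_algebra (taft_algebra N q)"
  using ideal.rcos_ring_hom[OF ideal_taft_ideal] by (simp add: taft_algebra_def taft_class_def[abs_def])

lemma taft_ring: "ring (taft_algebra N q)"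
  unfolding taft_algebra_def by (rule ideal.quotient_is_ring[OF ideal_taft_ideal])

lemma free_const_central: "free_const c * f = f * free_const (c::'k::field)"
proof (induction f rule: update_induct)
  case (update f k v)
  have eq: "Poly_Mapping.update k v f = f + Poly_Mapping.single k v"
    using update.hyps
    by (intro poly_mapping_eqI)
       (auto simp: lookup_add lookup_single lookup_update when_def in_keys_iff)
  have "([]::taft_gen list) + k = k" "k + [] = k" by (simp_all add: plus_list_def)
  then have "free_const c * Poly_Mapping.single k v = Poly_Mapping.single k v * free_const c"
    by (simp add: free_const_def Poly_Mapping.mult_single mult.commute)
  then show ?case using update.IH by (simp add: eq distrib_left distrib_right)
qed simp

lemma taft_k_algebra: "k_algebra (taft_algebra N q) (taft_unit N q)"
proof -
  interpret ring "taft_algebra N q" by (rule taft_ring)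
  note h = taft_class_hom[of N q]
  have c: "taft_class N q f \<in> carrier (taft_algebra N q)" for f
    using h by (auto simp: ring_hom_def ring_of_type_algebra_def)
  have m: "taft_class N q (f * f') = taft_class N q f \<otimes>\<^bsub>taft_algebra N q\<^esub> taft_class N q f'" for f f'
    using h by (auto simp: ring_hom_def ring_of_type_algebra_def)
  have a: "taft_class N q (f + f') = taft_class N q f \<oplus>\<^bsub>taft_algebra N q\<^esub> taft_class N q f'" for f f'
    using h by (auto simp: ring_hom_def ring_of_type_algebra_def)
  have o: "taft_class N q 1 = \<one>\<^bsub>taft_algebra N q\<^esub>"
    using h by (auto simp: ring_hom_def ring_of_type_algebra_def)
  have f1: "free_const (1::'a) = 1"
    by (simp add: free_const_def flip: single_one zero_list_def)
  have nil: "([]::taft_gen list) + [] = []" by (simp add: plus_list_def)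
  have surj: "\<exists>f. y = taft_class N q f" if "y \<in> carrier (taft_algebra N q)" for y
    using that by (auto simp: taft_algebra_def FactRing_def A_RCOSETS_def' taft_class_def)
  show ?thesis
  proof (unfold_locales, goal_cases)
    case (5 y c)
    then obtain f where "y = taft_class N q f" using surj by blast
    then show ?case by (simp add: taft_unit_def free_const_central flip: m)
  qed (simp_all add: taft_unit_def c o f1 flip: a m,
       simp_all add: free_const_def single_add Poly_Mapping.mult_single nil)
qed
definition taft_hopf :: "nat \<Rightarrow> 'k::field \<Rightarrow>
    ('k free_alg set \<Rightarrow> (('k free_alg set \<Rightarrow> 'k free_alg set \<Rightarrow> 'k free_alg set) \<Rightarrow> 'k free_alg set)) \<Rightarrow>
    ('k free_alg set \<Rightarrow> 'k) \<Rightarrow> ('k free_alg set \<Rightarrow> 'k free_alg set) \<Rightarrow> bool" where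
  "taft_hopf N q \<Delta> \<epsilon> S \<longleftrightarrow>
    (let A = taft_algebra N q; \<iota> = taft_unit N q; g = taft_g N q; x = taft_x N q in
      hopf_algebra A \<iota> \<Delta> \<epsilon> S \<and>
      \<Delta> g = pure_tensor A \<iota> g g \<and>
      \<Delta> x = pure_tensor A \<iota> g x \<oplus>\<^bsub>tensor_square A \<iota>\<^esub> pure_tensor A \<iota> x \<one>\<^bsub>A\<^esub> \<and>
      S g = inv\<^bsub>A\<^esub> g \<and>
      S x = \<ominus>\<^bsub>A\<^esub> (inv\<^bsub>A\<^esub> g \<otimes>\<^bsub>A\<^esub> x))"

definition taft_integral :: "nat \<Rightarrow> 'k::field \<Rightarrow> ('k free_alg set \<Rightarrow> 'k) \<Rightarrow> bool" where
  "taft_integral N q l \<longleftrightarrow>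
    (let A = taft_algebra N q in
      (\<forall>y\<in>carrier A. \<forall>z\<in>carrier A. l (y \<oplus>\<^bsub>A\<^esub> z) = l y + l z) \<and>
      (\<forall>c. \<forall>y\<in>carrier A. l (taft_unit N q c \<otimes>\<^bsub>A\<^esub> y) = c * l y) \<and>
      (\<forall>(m::nat) (b::int). l (taft_x N q [^]\<^bsub>A\<^esub> m \<otimes>\<^bsub>A\<^esub> taft_g N q [^]\<^bsub>A\<^esub> b) =
         (if m = N - 1 \<and> [b = 1] (mod int N) then 1 else 0)))"

definition taft_e :: "nat \<Rightarrow> 'k::field \<Rightarrow> int \<Rightarrow> 'k free_alg set" where
  "taft_e N q t = taft_unit N q (1 / of_nat N) \<otimes>\<^bsub>taft_algebra N q\<^esub>
     (\<Oplus>\<^bsub>taft_algebra N q\<^esub>i\<in>{0..N - 1}.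
        taft_unit N q (q powi (t * int i)) \<otimes>\<^bsub>taft_algebra N q\<^esub> taft_g N q [^]\<^bsub>taft_algebra N q\<^esub> i)"

definition taft_R :: "nat \<Rightarrow> 'k::field \<Rightarrow> 'k free_alg set set" where
  "taft_R N q = generate_ring (taft_algebra N q) (insert (taft_x N q) (range (taft_unit N q)))"

definition taft_N :: "nat \<Rightarrow> 'k::field \<Rightarrow> int \<Rightarrow> nat \<Rightarrow> 'k free_alg set set" where
  "taft_N N q s t = (taft_e N q s \<otimes>\<^bsub>taft_algebra N q\<^esub> taft_x N q [^]\<^bsub>taft_algebra N q\<^esub> t)
     <#\<^bsub>taft_algebra N q\<^esub> taft_R N q"


section \<open>Orthogonals and direct sums\<close>

definition taft_form :: "nat \<Rightarrow> 'k::field \<Rightarrow> ('k free_alg set \<Rightarrow> 'k free_alg set) \<Rightarrow>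
    ('k free_alg set \<Rightarrow> 'k) \<Rightarrow> 'k free_alg set \<Rightarrow> 'k free_alg set \<Rightarrow> 'k" where
  "taft_form N q S l y z = l (z \<otimes>\<^bsub>taft_algebra N q\<^esub> S y)"

definition left_orth :: "('a, 'b) ring_scheme \<Rightarrow> ('a \<Rightarrow> 'a \<Rightarrow> 'k::zero) \<Rightarrow> 'a set \<Rightarrow> 'a set" where
  "left_orth A B W = {v \<in> carrier A. \<forall>w\<in>W. B v w = 0}"

definition right_orth :: "('a, 'b) ring_scheme \<Rightarrow> ('a \<Rightarrow> 'a \<Rightarrow> 'k::zero) \<Rightarrow> 'a set \<Rightarrow> 'a set" where
  "right_orth A B W = {v \<in> carrier A. \<forall>w\<in>W. B w v = 0}"

definition is_direct_sum ::
  "('a, 'b) ring_scheme \<Rightarrow> 'a set \<Rightarrow> 'i set \<Rightarrow> ('i \<Rightarrow> 'a set) \<Rightarrow> bool" where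
  "is_direct_sum A W I V \<longleftrightarrow>
     W = {finsum A v I | v. v \<in> (\<Pi> i\<in>I. V i)} \<and>
     (\<forall>v \<in> (\<Pi> i\<in>I. V i). finsum A v I = \<zero>\<^bsub>A\<^esub> \<longrightarrow> (\<forall>i\<in>I. v i = \<zero>\<^bsub>A\<^esub>))"

definition is_direct_sum2 :: "('a, 'b) ring_scheme \<Rightarrow> 'a set \<Rightarrow> 'a set \<Rightarrow> 'a set \<Rightarrow> bool" where
  "is_direct_sum2 A W U V \<longleftrightarrow> W = U <+>\<^bsub>A\<^esub> V \<and> U \<inter> V = {\<zero>\<^bsub>A\<^esub>}"

end

theory Submission
  imports Defs
begin

text \<open>
  Write \<open>\<langle>y, z\<rangle> = \<lambda> (z S(y))\<close>. The proof rests on two computations with the elements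
  \<open>e\<^sub>s x\<^sup>i\<close>, where the \<open>e\<^sub>s\<close> are the orthogonal idempotents that diagonalise multiplication by \<open>g\<close>.

  First, these elements span \<open>A\<close>, and the form pairs them almost like a basis with its dual basis:
  \<open>\<langle>e\<^sub>s x\<^sup>i, e\<^sub>t x\<^sup>j\<rangle>\<close> is nonzero exactly if \<open>i + j = N - 1\<close> and \<open>s + t \<equiv> 1\<close>. The reason is that \<open>S\<close>
  reverses products, so \<open>S(e\<^sub>s x\<^sup>i)\<close> is a nonzero multiple of \<open>e\<^bsub>-s-i\<^esub> x\<^sup>i\<close>, and that \<open>\<lambda>\<close> sees only
  the top power \<open>x\<^bsup>N-1\<^esup>\<close>. The condition is symmetric in the two arguments. Every form with this
  property satisfies
  \<open>N\<^bsub>s,m\<^esub>\<^sup>\<bottom> = {y. e\<^bsub>1-s\<^esub> y \<in> N\<^bsub>1-s,N-m\<^esub>}\<close> (lemma \<open>taft_pairing_right_orth\<close>), and applying this to the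
  form and to its flip shows that the left and right orthogonals of \<open>N\<^bsub>s,m\<^esub>\<close> agree. Both direct sum
  decompositions are then the Peirce decomposition of \<open>A\<close> for \<open>1 = \<Sum> e\<^sub>t\<close>: for \<open>m = 0\<close> the orthogonal
  is the annihilator of \<open>e\<^bsub>1-s\<^esub>\<close> (lemma \<open>annihilator_direct_sum\<close>), and in general it is that
  annihilator plus a subspace of \<open>e\<^bsub>1-s\<^esub> A\<close> (lemma \<open>preimage_direct_sum2\<close>).

  Second, \<open>\<lambda>(y x) = q \<lambda>(x y)\<close> and \<open>\<lambda>(y g) = q \<lambda>(g y)\<close>. For \<open>a \<in> R\<close> these give
  \<open>\<lambda>(z S(a)) = \<lambda>(S(a) z)\<close> and \<open>\<lambda>(a z) = \<lambda>(z S\<^sup>2(a))\<close>, hence \<open>\<langle>a y, z\<rangle> = \<langle>y, S(a) z\<rangle>\<close> and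
  \<open>\<langle>z, a y\<rangle> = \<langle>S(a) z, y\<rangle>\<close> (lemmas \<open>form_mult_left\<close> and \<open>form_mult_right\<close>). So on either side the
  orthogonal of \<open>a N\<^bsub>s,m\<^esub>\<close> is the preimage of \<open>N\<^bsub>s,m\<^esub>\<^sup>\<bottom>\<close> under multiplication by the unit \<open>S(a)\<close>,
  that is, \<open>S(a\<^sup>-\<^sup>1) N\<^bsub>s,m\<^esub>\<^sup>\<bottom>\<close>.

  That \<open>S\<close> reverses products follows from the Hopf axioms by cancelling \<open>id\<close> in the convolution
  algebra of endomorphisms of \<open>A\<close> (lemma \<open>convolution_left_cancel\<close>): \<open>z \<mapsto> S(z g)\<close> and
  \<open>z \<mapsto> S(z x)\<close> are determined by the counit of \<open>z g\<close> and \<open>z x\<close>, and \<open>g\<close>, \<open>x\<close> generate \<open>A\<close>.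
\<close>

section \<open>Linear algebra over a field inside a ring\<close>

context k_algebra
begin

text \<open>An opaque name for \<open>\<iota> c \<otimes> y\<close>: with it, moving scalars to the front of a product is a terminating
  set of rewrite rules, whereas the centrality of \<open>\<iota> c\<close> alone would loop.\<close>

definition smul :: "'k \<Rightarrow> 'a \<Rightarrow> 'a" (infixr "\<star>" 75) where
  "c \<star> y = \<iota> c \<otimes> y"

lemma smul_closed [simp, intro]: "y \<in> carrier A \<Longrightarrow> c \<star> y \<in> carrier A"
  by (simp add: smul_def unit_closed)

lemma unit_zero: "\<iota> 0 = \<zero>"
  using unit_add[of 0 0] unit_closed[of 0] by (metis add.r_cancel_one' add_0)

lemma smul_zero_left [simp]: "y \<in> carrier A \<Longrightarrow> 0 \<star> y = \<zero>"
  by (simp add: smul_def unit_zero)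

lemma smul_zero_right [simp]: "c \<star> \<zero> = \<zero>"
  by (simp add: smul_def unit_closed)

lemma smul_one [simp]: "y \<in> carrier A \<Longrightarrow> 1 \<star> y = y"
  by (simp add: smul_def unit_one)

lemma smul_smul [simp]: "y \<in> carrier A \<Longrightarrow> c \<star> d \<star> y = (c * d) \<star> y"
  by (simp add: smul_def unit_mult m_assoc unit_closed)

lemma smul_mult_left [simp]:
  "\<lbrakk>y \<in> carrier A; z \<in> carrier A\<rbrakk> \<Longrightarrow> (c \<star> y) \<otimes> z = c \<star> (y \<otimes> z)"
  by (simp add: smul_def m_assoc unit_closed)

lemma smul_mult_right [simp]:
  "\<lbrakk>y \<in> carrier A; z \<in> carrier A\<rbrakk> \<Longrightarrow> y \<otimes> (c \<star> z) = c \<star> (y \<otimes> z)"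
  by (metis smul_def m_assoc unit_closed unit_central)

lemma smul_add_right:
  "\<lbrakk>y \<in> carrier A; z \<in> carrier A\<rbrakk> \<Longrightarrow> c \<star> (y \<oplus> z) = c \<star> y \<oplus> c \<star> z"
  by (simp add: smul_def r_distr unit_closed)

lemma smul_add_left: "y \<in> carrier A \<Longrightarrow> (c + d) \<star> y = c \<star> y \<oplus> d \<star> y"
  by (simp add: smul_def l_distr unit_add unit_closed)

lemma smul_minus_one: "y \<in> carrier A \<Longrightarrow> \<ominus> y = (- 1) \<star> y"
  using smul_add_left[of y 1 "- 1"] by (simp add: minus_equality add.m_comm)

lemma smul_finsum:
  assumes "v \<in> I \<rightarrow> carrier A"
  shows "c \<star> finsum A v I = (\<Oplus>i\<in>I. c \<star> v i)"
proof (cases "finite I")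
  case True
  then show ?thesis
    using assms by (simp add: smul_def finsum_rdistr unit_closed)
next
  case False
  then show ?thesis by (simp add: finsum_infinite)
qed

lemma sum_smul:
  assumes "finite I" "y \<in> carrier A"
  shows "(\<Oplus>i\<in>I. c i \<star> y) = sum c I \<star> y"
  using assms(1) by induction (simp_all add: assms(2) smul_add_left Pi_def)

lemma finsum_swap:
  assumes "finite I" "finite J" "\<And>i j. i \<in> I \<Longrightarrow> j \<in> J \<Longrightarrow> v i j \<in> carrier A"
  shows "(\<Oplus>i\<in>I. \<Oplus>j\<in>J. v i j) = (\<Oplus>j\<in>J. \<Oplus>i\<in>I. v i j)"
  using assms(1,3)
proof (induction I)
  case empty
  then show ?case by simp
next
  case (insert i I)
  have "(\<Oplus>j\<in>J. \<Oplus>i\<in>insert i I. v i j) = (\<Oplus>j\<in>J. v i j \<oplus> (\<Oplus>i\<in>I. v i j))"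
    using insert.hyps insert.prems by (intro finsum_cong') auto
  also have "\<dots> = (\<Oplus>j\<in>J. v i j) \<oplus> (\<Oplus>j\<in>J. \<Oplus>i\<in>I. v i j)"
    using insert.prems by (intro finsum_addf) auto
  also have "\<dots> = (\<Oplus>j\<in>J. v i j) \<oplus> (\<Oplus>i\<in>I. \<Oplus>j\<in>J. v i j)"
    using insert by simp
  also have "\<dots> = (\<Oplus>i\<in>insert i I. \<Oplus>j\<in>J. v i j)"
    using insert.hyps insert.prems by (subst finsum_insert) (auto intro!: finsum_closed)
  finally show ?case by simp
qed

definition k_subspace :: "'a set \<Rightarrow> bool" where
  "k_subspace W \<longleftrightarrow> W \<subseteq> carrier A \<and> \<zero> \<in> W \<and> (\<forall>y\<in>W. \<forall>z\<in>W. y \<oplus> z \<in> W) \<and> (\<forall>c. \<forall>y\<in>W. c \<star> y \<in> W)"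

definition k_functional :: "('a \<Rightarrow> 'k) \<Rightarrow> bool" where
  "k_functional f \<longleftrightarrow> (\<forall>y\<in>carrier A. \<forall>z\<in>carrier A. f (y \<oplus> z) = f y + f z) \<and>
     (\<forall>c. \<forall>y\<in>carrier A. f (c \<star> y) = c * f y)"

definition k_endo :: "('a \<Rightarrow> 'a) \<Rightarrow> bool" where
  "k_endo L \<longleftrightarrow> L \<in> carrier A \<rightarrow> carrier A \<and>
     (\<forall>y\<in>carrier A. \<forall>z\<in>carrier A. L (y \<oplus> z) = L y \<oplus> L z) \<and>
     (\<forall>c. \<forall>y\<in>carrier A. L (c \<star> y) = c \<star> L y)"

lemma k_functional_add:
  "\<lbrakk>k_functional f; y \<in> carrier A; z \<in> carrier A\<rbrakk> \<Longrightarrow> f (y \<oplus> z) = f y + f z"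
  and k_functional_smul: "\<lbrakk>k_functional f; y \<in> carrier A\<rbrakk> \<Longrightarrow> f (c \<star> y) = c * f y"
  by (auto simp: k_functional_def)

lemma k_functional_zero: "k_functional f \<Longrightarrow> f \<zero> = 0"
  using k_functional_smul[of f \<zero> 0] by simp

lemma k_functional_finsum:
  assumes "k_functional f" "finite I" "v \<in> I \<rightarrow> carrier A"
  shows "f (finsum A v I) = (\<Sum>i\<in>I. f (v i))"
  using assms(2,3)
  by induction (auto simp: k_functional_zero[OF assms(1)] k_functional_add[OF assms(1)] Pi_def)

lemma k_endo_closed: "\<lbrakk>k_endo L; y \<in> carrier A\<rbrakk> \<Longrightarrow> L y \<in> carrier A"
  and k_endo_add: "\<lbrakk>k_endo L; y \<in> carrier A; z \<in> carrier A\<rbrakk> \<Longrightarrow> L (y \<oplus> z) = L y \<oplus> L z"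
  and k_endo_smul: "\<lbrakk>k_endo L; y \<in> carrier A\<rbrakk> \<Longrightarrow> L (c \<star> y) = c \<star> L y"
  by (auto simp: k_endo_def)

lemma k_endo_zero: "k_endo L \<Longrightarrow> L \<zero> = \<zero>"
  using k_endo_smul[of L \<zero> 0] by (simp add: k_endo_closed)

lemma k_endo_finsum:
  assumes "k_endo L" "finite I" "v \<in> I \<rightarrow> carrier A"
  shows "L (finsum A v I) = (\<Oplus>i\<in>I. L (v i))"
  using assms(2,3)
  by induction
    (auto simp: k_endo_zero[OF assms(1)] k_endo_add[OF assms(1)] k_endo_closed[OF assms(1)] Pi_def)

lemma bilinear_mapsI:
  assumes "\<And>u v. \<lbrakk>u \<in> carrier A; v \<in> carrier A\<rbrakk> \<Longrightarrow> \<beta> u v \<in> carrier A"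
    and "\<And>u u' v. \<lbrakk>u \<in> carrier A; u' \<in> carrier A; v \<in> carrier A\<rbrakk> \<Longrightarrow> \<beta> (u \<oplus> u') v = \<beta> u v \<oplus> \<beta> u' v"
    and "\<And>u u' v. \<lbrakk>u \<in> carrier A; u' \<in> carrier A; v \<in> carrier A\<rbrakk> \<Longrightarrow> \<beta> v (u \<oplus> u') = \<beta> v u \<oplus> \<beta> v u'"
    and "\<And>c u v. \<lbrakk>u \<in> carrier A; v \<in> carrier A\<rbrakk> \<Longrightarrow> \<beta> (c \<star> u) v = c \<star> \<beta> u v"
    and "\<And>c u v. \<lbrakk>u \<in> carrier A; v \<in> carrier A\<rbrakk> \<Longrightarrow> \<beta> u (c \<star> v) = c \<star> \<beta> u v"
  shows "\<beta> \<in> bilinear_maps A \<iota>"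
  using assms by (simp add: bilinear_maps_def smul_def)

lemma bilinear_closed:
    "\<lbrakk>\<beta> \<in> bilinear_maps A \<iota>; u \<in> carrier A; v \<in> carrier A\<rbrakk> \<Longrightarrow> \<beta> u v \<in> carrier A"
  and bilinear_add_left:
    "\<lbrakk>\<beta> \<in> bilinear_maps A \<iota>; u \<in> carrier A; u' \<in> carrier A; v \<in> carrier A\<rbrakk>
      \<Longrightarrow> \<beta> (u \<oplus> u') v = \<beta> u v \<oplus> \<beta> u' v"
  and bilinear_add_right:
    "\<lbrakk>\<beta> \<in> bilinear_maps A \<iota>; u \<in> carrier A; u' \<in> carrier A; v \<in> carrier A\<rbrakk>
      \<Longrightarrow> \<beta> v (u \<oplus> u') = \<beta> v u \<oplus> \<beta> v u'"
  and bilinear_smul_left: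
    "\<lbrakk>\<beta> \<in> bilinear_maps A \<iota>; u \<in> carrier A; v \<in> carrier A\<rbrakk> \<Longrightarrow> \<beta> (c \<star> u) v = c \<star> \<beta> u v"
  and bilinear_smul_right:
    "\<lbrakk>\<beta> \<in> bilinear_maps A \<iota>; u \<in> carrier A; v \<in> carrier A\<rbrakk> \<Longrightarrow> \<beta> u (c \<star> v) = c \<star> \<beta> u v"
  by (auto simp: bilinear_maps_def smul_def)

lemmas bilinear_simps = bilinear_closed bilinear_add_left bilinear_add_right
  bilinear_smul_left bilinear_smul_right

lemma bilinear_maps_cong:
  assumes b: "\<beta> \<in> bilinear_maps A \<iota>"
    and eq: "\<And>u v. \<lbrakk>u \<in> carrier A; v \<in> carrier A\<rbrakk> \<Longrightarrow> \<beta> u v = \<beta>' u v"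
  shows "\<beta>' \<in> bilinear_maps A \<iota>"
  by (intro bilinear_mapsI) (simp_all add: bilinear_simps[OF b] flip: eq)

lemmas k_endo_simps = k_endo_closed k_endo_add k_endo_smul

lemma bilinear_mult:
  assumes "k_endo K" "k_endo L"
  shows "(\<lambda>u v. K u \<otimes> L v) \<in> bilinear_maps A \<iota>"
  using assms
  by (intro bilinear_mapsI) (simp_all add: k_endo_closed k_endo_add k_endo_smul l_distr r_distr)

lemma k_endo_id: "k_endo (\<lambda>y. y)"
  by (simp add: k_endo_def)

lemma k_endo_const_zero: "k_endo (\<lambda>y. \<zero>)"
  by (simp add: k_endo_def)

lemma k_endo_mult_left: "\<lbrakk>a \<in> carrier A; k_endo L\<rbrakk> \<Longrightarrow> k_endo (\<lambda>y. a \<otimes> L y)"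
  by (auto simp: k_endo_def r_distr Pi_def)

lemma k_endo_mult_right: "\<lbrakk>a \<in> carrier A; k_endo L\<rbrakk> \<Longrightarrow> k_endo (\<lambda>y. L (y \<otimes> a))"
  by (auto simp: k_endo_def l_distr Pi_def)

lemma k_endo_plus: "\<lbrakk>k_endo K; k_endo L\<rbrakk> \<Longrightarrow> k_endo (\<lambda>y. K y \<oplus> L y)"
  by (auto simp: k_endo_def smul_add_right Pi_def a_ac)

end

section \<open>The antipode on products with grouplike and skew-primitive elements\<close>

context hopf_algebra
begin

lemma k_endo_antipode: "k_endo S"
  using antipode_closed antipode_add antipode_scale by (auto simp: k_endo_def smul_def)

lemma antipode_in_carrier [simp, intro]: "y \<in> carrier A \<Longrightarrow> S y \<in> carrier A"
  using k_endo_closed[OF k_endo_antipode] .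

text \<open>The \<open>u\<^sub>i\<close> and \<open>v\<^sub>i\<close> are the Sweedler components of \<open>h\<close>.\<close>

lemma comult_sweedler:
  assumes "h \<in> carrier A"
  obtains n :: nat and u v where "u \<in> {..<n} \<rightarrow> carrier A" "v \<in> {..<n} \<rightarrow> carrier A"
    "\<Delta> h = (\<lambda>\<beta>\<in>bilinear_maps A \<iota>. \<Oplus>i\<in>{..<n}. \<beta> (u i) (v i))"
proof -
  have "\<Delta> h \<in> carrier (tensor_square A \<iota>)"
    using comult_hom assms by (auto simp: ring_hom_def)
  then show ?thesis
    using that by (auto simp: tensor_square_def)
qed

text \<open>Off \<open>bilinear_maps A \<iota>\<close> the tensor \<open>\<Delta> h\<close> has a fixed default value, and being bilinear depends only
  on the values on the carrier. Hence the congruence also covers maps that are not bilinear.\<close>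

lemma comult_cong:
  assumes h: "h \<in> carrier A"
    and eq: "\<And>u v. \<lbrakk>u \<in> carrier A; v \<in> carrier A\<rbrakk> \<Longrightarrow> \<beta> u v = \<beta>' u v"
  shows "\<Delta> h \<beta> = \<Delta> h \<beta>'"
proof -
  obtain n :: nat and u v where uv: "u \<in> {..<n} \<rightarrow> carrier A" "v \<in> {..<n} \<rightarrow> carrier A"
    and D: "\<Delta> h = (\<lambda>\<beta>\<in>bilinear_maps A \<iota>. \<Oplus>i\<in>{..<n}. \<beta> (u i) (v i))"
    by (rule comult_sweedler[OF h])
  have iff: "\<beta> \<in> bilinear_maps A \<iota> \<longleftrightarrow> \<beta>' \<in> bilinear_maps A \<iota>"
    using bilinear_maps_cong[of \<beta> \<beta>'] bilinear_maps_cong[of \<beta>' \<beta>] eq by fastforce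
  have "(\<Oplus>i\<in>{..<n}. \<beta> (u i) (v i)) = (\<Oplus>i\<in>{..<n}. \<beta>' (u i) (v i))"
    if b: "\<beta>' \<in> bilinear_maps A \<iota>"
  proof (rule finsum_cong')
    show "(\<lambda>i. \<beta>' (u i) (v i)) \<in> {..<n} \<rightarrow> carrier A"
      using uv by (intro funcsetI bilinear_closed[OF b]) auto
    show "\<beta> (u i) (v i) = \<beta>' (u i) (v i)" if "i \<in> {..<n}" for i
      using uv that by (intro eq) auto
  qed simp
  then show ?thesis
    using iff by (simp add: D)
qed

lemma comult_linear:
  assumes h: "h \<in> carrier A" and b: "\<beta> \<in> bilinear_maps A \<iota>" and L: "k_endo L"
  shows "\<Delta> h (\<lambda>u v. L (\<beta> u v)) = L (\<Delta> h \<beta>)"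
proof -
  have b': "(\<lambda>u v. L (\<beta> u v)) \<in> bilinear_maps A \<iota>"
    using L by (intro bilinear_mapsI) (simp_all add: bilinear_simps[OF b] k_endo_simps)
  obtain n :: nat and u v where uv: "u \<in> {..<n} \<rightarrow> carrier A" "v \<in> {..<n} \<rightarrow> carrier A"
    and D: "\<Delta> h = (\<lambda>\<beta>\<in>bilinear_maps A \<iota>. \<Oplus>i\<in>{..<n}. \<beta> (u i) (v i))"
    by (rule comult_sweedler[OF h])
  have "(\<lambda>i. \<beta> (u i) (v i)) \<in> {..<n} \<rightarrow> carrier A"
    using uv by (intro funcsetI bilinear_closed[OF b]) auto
  then show ?thesis
    using b b' by (simp add: D k_endo_finsum[OF L])
qed

lemma counit_smul: "y \<in> carrier A \<Longrightarrow> \<epsilon> (c \<star> y) = c * \<epsilon> y"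
  by (simp add: smul_def counit_mult unit_closed counit_unit)

text \<open>This is \<open>L = (S * id) * L = S * (id * L)\<close> in the convolution algebra: coassociativity applied to the
  trilinear map \<open>(a, b, c) \<mapsto> S(a) b L(c)\<close>.\<close>

lemma endo_eq_antipode_convolution:
  assumes L: "k_endo L" and h: "h \<in> carrier A"
  shows "L h = \<Delta> h (\<lambda>u v. S u \<otimes> \<Delta> v (\<lambda>b c. b \<otimes> L c))"
proof -
  let ?\<gamma> = "\<lambda>a b c. S a \<otimes> b \<otimes> L c"
  note S = k_endo_antipode
  have tri: "?\<gamma> \<in> trilinear_maps A \<iota>"
    unfolding trilinear_maps_def
    by (auto intro!: bilinear_mapsI simp: k_endo_simps[OF S] k_endo_simps[OF L] l_distr r_distr)
  have e: "(\<lambda>u v. \<epsilon> u \<star> v) \<in> bilinear_maps A \<iota>"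
    by (intro bilinear_mapsI)
      (simp_all add: counit_add counit_smul smul_add_left smul_add_right mult.commute)
  have inner_left: "\<Delta> u (\<lambda>a b. ?\<gamma> a b v) = L (\<epsilon> u \<star> v)"
    if uv: "u \<in> carrier A" "v \<in> carrier A" for u v
  proof -
    have K: "k_endo (\<lambda>y. y \<otimes> L v)"
      using uv by (simp add: k_endo_def l_distr k_endo_closed[OF L])
    show ?thesis
      using comult_linear[OF uv(1) bilinear_mult[OF S k_endo_id] K] antipode_left[OF uv(1)]
      by (simp add: smul_def[symmetric] k_endo_smul[OF L] uv)
  qed
  have inner_right: "\<Delta> v (\<lambda>b c. ?\<gamma> u b c) = S u \<otimes> \<Delta> v (\<lambda>b c. b \<otimes> L c)"
    if uv: "u \<in> carrier A" "v \<in> carrier A" for u v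
  proof -
    have K: "k_endo (\<lambda>y. S u \<otimes> y)"
      using uv by (intro k_endo_mult_left k_endo_id) simp
    have "\<Delta> v (\<lambda>b c. ?\<gamma> u b c) = \<Delta> v (\<lambda>b c. S u \<otimes> (b \<otimes> L c))"
      using uv by (intro comult_cong) (simp_all add: m_assoc k_endo_closed[OF L])
    then show ?thesis
      using comult_linear[OF uv(2) bilinear_mult[OF k_endo_id L] K] by simp
  qed
  have "L h = L (\<Delta> h (\<lambda>u v. \<epsilon> u \<star> v))"
    using counit_left[OF h] by (simp add: smul_def)
  also have "\<dots> = \<Delta> h (\<lambda>u v. L (\<epsilon> u \<star> v))"
    using comult_linear[OF h e L] by simp
  also have "\<dots> = \<Delta> h (\<lambda>u v. \<Delta> u (\<lambda>a b. ?\<gamma> a b v))"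
    by (intro comult_cong h) (simp add: inner_left)
  also have "\<dots> = \<Delta> h (\<lambda>u v. \<Delta> v (\<lambda>b c. ?\<gamma> u b c))"
    by (rule coassoc[OF h tri])
  also have "\<dots> = \<Delta> h (\<lambda>u v. S u \<otimes> \<Delta> v (\<lambda>b c. b \<otimes> L c))"
    by (intro comult_cong h) (simp add: inner_right)
  finally show ?thesis .
qed

lemma convolution_left_cancel:
  assumes "k_endo K" "k_endo L"
    and eq: "\<And>y. y \<in> carrier A \<Longrightarrow> \<Delta> y (\<lambda>u v. u \<otimes> K v) = \<Delta> y (\<lambda>u v. u \<otimes> L v)"
    and h: "h \<in> carrier A"
  shows "K h = L h"
  unfolding endo_eq_antipode_convolution[OF assms(1) h] endo_eq_antipode_convolution[OF assms(2) h]
  by (intro comult_cong h) (simp add: eq)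

text \<open>The axiom \<open>id * S = \<iota> \<circ> \<epsilon>\<close> at a product, with the comultiplication of the product expanded.\<close>

lemma antipode_right_mult:
  assumes y: "y \<in> carrier A" and z: "z \<in> carrier A"
  shows "\<Delta> y (\<lambda>a b. \<Delta> z (\<lambda>c d. (a \<otimes> c) \<otimes> S (b \<otimes> d))) = \<iota> (\<epsilon> y * \<epsilon> z)"
proof -
  have b: "(\<lambda>u v. u \<otimes> S v) \<in> bilinear_maps A \<iota>"
    by (rule bilinear_mult[OF k_endo_id k_endo_antipode])
  have "\<Delta> (y \<otimes> z) (\<lambda>u v. u \<otimes> S v) =
      \<Delta> y (\<lambda>a b. \<Delta> z (\<lambda>c d. (a \<otimes> c) \<otimes> S (b \<otimes> d)))"
    using ring_hom_mult[OF comult_hom y z] b by (simp add: tensor_square_def)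
  then show ?thesis
    using antipode_right[of "y \<otimes> z"] y z by (simp add: counit_mult)
qed

lemma bilinear_antipode_mult:
  assumes "a \<in> carrier A" "b \<in> carrier A"
  shows "(\<lambda>c d. (a \<otimes> c) \<otimes> S (b \<otimes> d)) \<in> bilinear_maps A \<iota>"
  using assms
  by (intro bilinear_mapsI) (simp_all add: k_endo_simps[OF k_endo_antipode] l_distr r_distr)

lemma antipode_one: "S \<one> = \<one>"
proof -
  have b: "(\<lambda>u v. S u \<otimes> v) \<in> bilinear_maps A \<iota>"
    by (rule bilinear_mult[OF k_endo_antipode k_endo_id])
  have "\<Delta> \<one> (\<lambda>u v. S u \<otimes> v) = S \<one> \<otimes> \<one>"
    using comult_unit[of 1] b by (simp add: unit_one pure_tensor_def)
  then show ?thesis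
    using antipode_left[of \<one>] counit_unit[of 1] by (simp add: unit_one)
qed

lemma counit_grouplike:
  assumes g: "g \<in> Units A" and grp: "\<Delta> g = pure_tensor A \<iota> g g"
  shows "\<epsilon> g = 1"
proof -
  have gA: "g \<in> carrier A" using g by (rule Units_closed)
  have "(\<lambda>u v. \<epsilon> u \<star> v) \<in> bilinear_maps A \<iota>"
    by (intro bilinear_mapsI)
      (simp_all add: counit_add counit_smul smul_add_left smul_add_right mult.commute)
  then have "\<iota> (\<epsilon> g) \<otimes> g = \<one> \<otimes> g"
    using counit_left[OF gA] gA by (simp add: grp pure_tensor_def smul_def)
  then have "\<iota> (\<epsilon> g) = \<iota> 1"
    using g gA unit_closed by (metis Units_inv_closed Units_r_inv m_assoc one_closed r_one unit_one)
  then show ?thesis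
    by (metis counit_unit)
qed

text \<open>The endomorphism \<open>y \<mapsto> g S(y g)\<close> is a right convolution inverse of the identity, because
  \<open>\<Delta>(y g) = \<Sum> y\<^sub>1 g \<otimes> y\<^sub>2 g\<close>; so it equals \<open>S\<close>.\<close>

lemma antipode_mult_grouplike:
  assumes g: "g \<in> Units A" and grp: "\<Delta> g = pure_tensor A \<iota> g g"
    and h: "h \<in> carrier A"
  shows "S (h \<otimes> g) = inv g \<otimes> S h"
proof -
  have gA: "g \<in> carrier A" using g by (rule Units_closed)
  have "g \<otimes> S (h \<otimes> g) = S h"
  proof (rule convolution_left_cancel[OF _ k_endo_antipode _ h])
    show "k_endo (\<lambda>y. g \<otimes> S (y \<otimes> g))"
      by (intro k_endo_mult_left k_endo_mult_right gA k_endo_antipode)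
    fix y assume y: "y \<in> carrier A"
    have "\<Delta> y (\<lambda>a b. a \<otimes> (g \<otimes> S (b \<otimes> g))) =
        \<Delta> y (\<lambda>a b. \<Delta> g (\<lambda>c d. (a \<otimes> c) \<otimes> S (b \<otimes> d)))"
      using gA
      by (intro comult_cong y) (simp add: grp pure_tensor_def m_assoc bilinear_antipode_mult)
    then show "\<Delta> y (\<lambda>a b. a \<otimes> (g \<otimes> S (b \<otimes> g))) = \<Delta> y (\<lambda>a b. a \<otimes> S b)"
      using antipode_right_mult[OF y gA] antipode_right[OF y] counit_grouplike[OF g grp] by simp
  qed
  then have "inv g \<otimes> (g \<otimes> S (h \<otimes> g)) = inv g \<otimes> S h" by simp
  then show ?thesis
    using g gA h by (simp flip: m_assoc)
qed

text \<open>Here \<open>\<Delta>(y x) = \<Sum> y\<^sub>1 g \<otimes> y\<^sub>2 x + \<Sum> y\<^sub>1 x \<otimes> y\<^sub>2\<close> and \<open>\<epsilon>(y x) = 0\<close>, so the identity convolved with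
  \<open>y \<mapsto> g S(y x) + x S(y)\<close> vanishes, and this endomorphism is zero.\<close>

lemma antipode_mult_skew_primitive:
  assumes g: "g \<in> Units A" and x: "x \<in> carrier A" and counit: "\<epsilon> x = 0"
    and skew: "\<Delta> x = pure_tensor A \<iota> g x \<oplus>\<^bsub>tensor_square A \<iota>\<^esub> pure_tensor A \<iota> x \<one>"
    and h: "h \<in> carrier A"
  shows "S (h \<otimes> x) = \<ominus> (inv g \<otimes> x) \<otimes> S h"
proof -
  note S = k_endo_antipode
  have gA: "g \<in> carrier A" using g by (rule Units_closed)
  have "g \<otimes> S (h \<otimes> x) \<oplus> x \<otimes> S h = \<zero>"
  proof (rule convolution_left_cancel[OF _ k_endo_const_zero _ h])
    show "k_endo (\<lambda>y. g \<otimes> S (y \<otimes> x) \<oplus> x \<otimes> S y)"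
      by (intro k_endo_plus k_endo_mult_left k_endo_mult_right gA x S)
    fix y assume y: "y \<in> carrier A"
    have "\<Delta> y (\<lambda>a b. a \<otimes> (g \<otimes> S (b \<otimes> x) \<oplus> x \<otimes> S b)) =
        \<Delta> y (\<lambda>a b. \<Delta> x (\<lambda>c d. (a \<otimes> c) \<otimes> S (b \<otimes> d)))"
      using gA x
      by (intro comult_cong y)
        (simp add: skew tensor_square_def pure_tensor_def m_assoc r_distr bilinear_antipode_mult)
    then have "\<Delta> y (\<lambda>a b. a \<otimes> (g \<otimes> S (b \<otimes> x) \<oplus> x \<otimes> S b)) = \<zero>"
      using antipode_right_mult[OF y x] counit by (simp add: unit_zero)
    moreover have "\<Delta> y (\<lambda>u v. \<zero>) = \<zero>"
      using comult_linear[OF y bilinear_mult[OF k_endo_id k_endo_id] k_endo_const_zero] by simp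
    moreover have "\<Delta> y (\<lambda>u v. u \<otimes> \<zero>) = \<Delta> y (\<lambda>u v. \<zero>)"
      by (intro comult_cong y) simp
    ultimately show "\<Delta> y (\<lambda>a b. a \<otimes> (g \<otimes> S (b \<otimes> x) \<oplus> x \<otimes> S b)) =
        \<Delta> y (\<lambda>u v. u \<otimes> \<zero>)"
      by simp
  qed
  then have "g \<otimes> S (h \<otimes> x) = \<ominus> (x \<otimes> S h)"
    using gA x h by (metis minus_equality minus_minus m_closed antipode_in_carrier)
  then have "inv g \<otimes> (g \<otimes> S (h \<otimes> x)) = inv g \<otimes> (\<ominus> (x \<otimes> S h))" by simp
  then show ?thesis
    using g gA x h by (simp add: l_minus r_minus m_assoc flip: m_assoc[of "inv g" g])
qed

end

section \<open>Sums over powers of a primitive root of unity\<close>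

lemma primitive_root_nonzero:
  assumes "primitive_root_of_unity N q"
  shows "q \<noteq> 0"
  using assms by (auto simp: primitive_root_of_unity_def power_0_left split: if_splits)

lemma primitive_root_power_int_eq_1_iff:
  assumes prim: "primitive_root_of_unity N q"
  shows "q powi k = 1 \<longleftrightarrow> [k = 0] (mod int N)"
proof -
  define r where "r = nat (k mod int N)"
  have N: "N > 0" "q ^ N = 1" and min: "\<And>j. 0 < j \<Longrightarrow> j < N \<Longrightarrow> q ^ j \<noteq> 1"
    using prim by (auto simp: primitive_root_of_unity_def)
  have q: "q \<noteq> 0" by (rule primitive_root_nonzero[OF prim])
  have r: "int r = k mod int N" "r < N"
    using N(1) by (auto simp: r_def nat_less_iff)
  have "q powi k = q powi (int N * (k div int N) + int r)"
    by (simp add: r)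
  also have "\<dots> = (q powi int N) powi (k div int N) * q ^ r"
    using q by (simp add: power_int_add power_int_mult)
  also have "\<dots> = q ^ r" by (simp add: N(2))
  finally have "q powi k = 1 \<longleftrightarrow> r = 0"
    using min[of r] r(2) by (cases "r = 0") auto
  then show ?thesis
    using r(1) by (simp add: cong_def flip: of_nat_eq_0_iff[where 'a = int])
qed

lemma sum_powers_primitive_root:
  assumes prim: "primitive_root_of_unity N q"
  shows "(\<Sum>i<N. q powi (k * int i)) = (if [k = 0] (mod int N) then of_nat N else (0::'k::field))"
proof -
  define w where "w = q powi k"
  have "w ^ N = 1"
    using prim unfolding w_def primitive_root_of_unity_def
    by (metis mult.commute power_int_1_left power_int_mult power_int_of_nat)
  moreover have "(\<Sum>i<N. q powi (k * int i)) = (\<Sum>i<N. w ^ i)"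
    by (simp add: w_def power_int_mult)
  ultimately show ?thesis
    using geometric_sum[of w N] primitive_root_power_int_eq_1_iff[OF prim, of k]
    by (auto simp: w_def[symmetric])
qed

text \<open>The characteristic does not divide \<open>N\<close>: otherwise \<open>1 + X + \<dots> + X\<^bsup>N-1\<^esup>\<close> would vanish at all \<open>N\<close> powers
  of \<open>q\<close>, including \<open>1\<close>.\<close>

lemma primitive_root_of_nat_nonzero:
  assumes prim: "primitive_root_of_unity N (q::'k::field)"
  shows "of_nat N \<noteq> (0::'k)"
proof
  assume N0: "of_nat N = (0::'k)"
  define p :: "'k poly" where "p = (\<Sum>i<N. monom 1 i)"
  have N: "N > 0" using prim by (simp add: primitive_root_of_unity_def)
  have root: "poly p (q powi int j) = 0" for j
    using sum_powers_primitive_root[OF prim, of "int j"] N0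
    by (simp add: p_def poly_sum poly_monom power_int_mult split: if_splits)
  have "inj_on (\<lambda>j. q powi int j) {..<N}"
  proof (rule inj_onI)
    fix i j assume ij: "i \<in> {..<N}" "j \<in> {..<N}" and eq: "q powi int i = q powi int j"
    have "q powi (int i - int j) = 1"
      using eq primitive_root_nonzero[OF prim] by (simp add: power_int_diff)
    then have "[int i = int j] (mod int N)"
      using primitive_root_power_int_eq_1_iff[OF prim] cong_diff_iff_cong_0 by blast
    then show "i = j"
      using ij by (simp add: cong_int_iff cong_less_modulus_unique_nat)
  qed
  moreover have "p \<noteq> 0"
  proof -
    have "coeff p 0 = 1" using N by (simp add: p_def coeff_sum)
    then show ?thesis by auto
  qed
  moreover from this have "finite {z. poly p z = 0}" by (rule poly_roots_finite)
  ultimately have "N \<le> degree p"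
    using card_poly_roots_bound[of p] root
    by (metis (mono_tags, lifting) card_inj_on_le card_lessThan image_subsetI le_trans mem_Collect_eq)
  moreover have "degree p < N"
    unfolding p_def
    by (rule degree_lessI) (use N in \<open>auto simp: coeff_sum\<close>)
  ultimately show False by simp
qed

section \<open>Idempotents and generation of the Taft algebra\<close>

text \<open>Only the relations and the fact that \<open>g\<close> and \<open>x\<close> generate \<open>A\<close> are recorded. The latter takes the
  form of an induction principle: a subspace that contains \<open>\<one>\<close> and is stable under left
  multiplication by \<open>g\<close> and \<open>x\<close> is everything.\<close>

locale taft_presentation = k_algebra A \<iota>
  for A :: "('a, 'b) ring_scheme" (structure) and \<iota> :: "'k::field \<Rightarrow> 'a" +
  fixes g x :: 'a and q :: 'k and N :: nat
  assumes N_ge_2: "N \<ge> 2"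
    and primitive: "primitive_root_of_unity N q"
    and g_closed [simp]: "g \<in> carrier A"
    and x_closed [simp]: "x \<in> carrier A"
    and g_pow_N: "g [^] N = \<one>"
    and x_pow_N: "x [^] N = \<zero>"
    and g_x: "g \<otimes> x = q \<star> (x \<otimes> g)"
    and generation: "\<lbrakk>k_subspace W; \<one> \<in> W; \<And>w. w \<in> W \<Longrightarrow> g \<otimes> w \<in> W; \<And>w. w \<in> W \<Longrightarrow> x \<otimes> w \<in> W\<rbrakk>
      \<Longrightarrow> carrier A \<subseteq> W"
begin

definition e :: "int \<Rightarrow> 'a" where
  "e t = (1 / of_nat N) \<star> (\<Oplus>i\<in>{..<N}. (q powi (t * int i)) \<star> g [^] i)"

definition R :: "'a set" where
  "R = generate_ring A (insert x (range \<iota>))"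

text \<open>The right \<open>R\<close>-module \<open>N\<^bsub>s,t\<^esub> = e\<^sub>s x\<^sup>t R\<close>; the letter \<open>N\<close> is taken by the order of \<open>q\<close>.\<close>

definition M :: "int \<Rightarrow> nat \<Rightarrow> 'a set" where
  "M s t = (e s \<otimes> x [^] t) <# R"

lemma q_nonzero [simp]: "q \<noteq> 0"
  using primitive_root_nonzero[OF primitive] .

lemma N_nonzero [simp]: "of_nat N \<noteq> (0::'k)"
  using primitive_root_of_nat_nonzero[OF primitive] .

lemma e_closed [simp, intro]: "e t \<in> carrier A"
  unfolding e_def by (intro smul_closed finsum_closed funcsetI) simp

text \<open>\<open>e\<^sub>s\<close> is the projection onto the eigenspace of \<open>g\<close> for the eigenvalue \<open>q\<^bsup>-s\<^esup>\<close>.\<close>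

lemma e_eigenvector:
  assumes y: "y \<in> carrier A" and eig: "g \<otimes> y = (q powi (- t)) \<star> y"
  shows "e s \<otimes> y = (if [s = t] (mod int N) then y else \<zero>)"
proof -
  have pow: "g [^] i \<otimes> y = (q powi (- t * int i)) \<star> y" for i :: nat
  proof (induction i)
    case (Suc i)
    have "g [^] Suc i \<otimes> y = g [^] i \<otimes> (g \<otimes> y)"
      using y by (simp add: m_assoc)
    also have "\<dots> = (q powi (- t) * q powi (- t * int i)) \<star> y"
      using y by (simp add: eig Suc)
    also have "q powi (- t) * q powi (- t * int i) = q powi (- t * int (Suc i))"
      by (simp add: algebra_simps flip: power_int_add)
    finally show ?case .
  qed (use y in simp)
  have "e s \<otimes> y = (1 / of_nat N) \<star> (\<Oplus>i\<in>{..<N}. (q powi (s * int i)) \<star> g [^] i \<otimes> y)"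
    using y unfolding e_def
    by (subst smul_mult_left) (auto intro!: finsum_closed simp: finsum_ldistr Pi_def)
  also have "(\<Oplus>i\<in>{..<N}. (q powi (s * int i)) \<star> g [^] i \<otimes> y) =
      (\<Oplus>i\<in>{..<N}. (q powi ((s - t) * int i)) \<star> y)"
    using y by (intro finsum_cong') (simp_all add: pow algebra_simps flip: power_int_add)
  also have "\<dots> = (\<Sum>i<N. q powi ((s - t) * int i)) \<star> y"
    using y by (intro sum_smul) auto
  also have "(\<Sum>i<N. q powi ((s - t) * int i)) = (if [s = t] (mod int N) then of_nat N else 0)"
    using sum_powers_primitive_root[OF primitive, of "s - t"] by (simp add: cong_diff_iff_cong_0)
  finally show ?thesis using y by (simp split: if_splits)
qed

text \<open>The sum over one full period of an \<open>N\<close>-periodic family does not depend on where the period starts.\<close>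

lemma finsum_cyclic_shift:
  assumes "f \<in> UNIV \<rightarrow> carrier A" and "f N = f 0"
  shows "(\<Oplus>i\<in>{..<N}. f (Suc i)) = (\<Oplus>i\<in>{..<N}. f i)"
proof -
  obtain n where n: "N = Suc n" using N_ge_2 by (cases N) auto
  have f: "f i \<in> carrier A" for i using assms(1) by auto
  have "(\<Oplus>i\<in>{..n}. f (Suc i)) \<oplus> f 0 = (\<Oplus>i\<in>{..Suc n}. f i)"
    using f by (intro finsum_Suc2[symmetric]) auto
  also have "\<dots> = (\<Oplus>i\<in>{..n}. f i) \<oplus> f 0"
    using f assms(2) by (subst finsum_Suc) (auto simp: n a_comm)
  finally show ?thesis
    using f by (simp add: n lessThan_Suc_atMost Pi_def)
qed

lemma g_e: "g \<otimes> e t = (q powi (- t)) \<star> e t"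
proof -
  define f where "f i = (q powi (t * int i)) \<star> g [^] i" for i :: nat
  have f: "f i \<in> carrier A" for i by (simp add: f_def)
  have "q powi (t * int N) = 1"
    unfolding primitive_root_power_int_eq_1_iff[OF primitive] by (simp add: cong_def)
  then have per: "f N = f 0" by (simp add: f_def g_pow_N)
  have step: "g \<otimes> f i = (q powi (- t)) \<star> f (Suc i)" for i
  proof -
    have "g \<otimes> g [^] i = g [^] Suc i"
      using nat_pow_Suc2[OF g_closed, of i] by simp
    moreover have "q powi (- t) * q powi (t * int (Suc i)) = q powi (t * int i)"
      by (simp add: algebra_simps flip: power_int_add)
    ultimately show ?thesis by (simp add: f_def del: nat_pow_Suc of_nat_Suc)
  qed
  have "g \<otimes> e t = (1 / of_nat N) \<star> (\<Oplus>i\<in>{..<N}. g \<otimes> f i)"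
    using f unfolding e_def f_def[symmetric]
    by (subst smul_mult_right) (auto intro!: finsum_closed simp: finsum_rdistr Pi_def)
  also have "(\<Oplus>i\<in>{..<N}. g \<otimes> f i) = (q powi (- t)) \<star> (\<Oplus>i\<in>{..<N}. f (Suc i))"
    unfolding step using f by (intro smul_finsum[symmetric]) auto
  also have "\<dots> = (q powi (- t)) \<star> (\<Oplus>i\<in>{..<N}. f i)"
    using f per by (subst finsum_cyclic_shift) auto
  also have "(1 / of_nat N) \<star> (q powi (- t)) \<star> (\<Oplus>i\<in>{..<N}. f i) = (q powi (- t)) \<star> e t"
    using f by (simp add: e_def f_def[symmetric] finsum_closed Pi_def mult.commute)
  finally show ?thesis .
qed

lemma e_g: "e t \<otimes> g = (q powi (- t)) \<star> e t"
proof -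
  have "e t \<otimes> g = g \<otimes> e t"
  proof -
    have "g [^] i \<otimes> g = g \<otimes> g [^] i" for i :: nat
      by (metis g_closed nat_pow_Suc nat_pow_Suc2)
    then have "(\<Oplus>i\<in>{..<N}. (q powi (t * int i)) \<star> g [^] i) \<otimes> g =
        g \<otimes> (\<Oplus>i\<in>{..<N}. (q powi (t * int i)) \<star> g [^] i)"
      by (simp add: finsum_ldistr finsum_rdistr Pi_def)
    then show ?thesis
      unfolding e_def by (subst smul_mult_left smul_mult_right; (intro finsum_closed funcsetI)?; simp)+
  qed
  then show ?thesis by (simp add: g_e)
qed

lemma e_e: "e s \<otimes> e t = (if [s = t] (mod int N) then e t else \<zero>)"
  by (rule e_eigenvector[OF e_closed g_e])

lemma e_cong: "[s = t] (mod int N) \<Longrightarrow> e s = e t"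
proof -
  assume st: "[s = t] (mod int N)"
  have "q powi (s * int i) = q powi (t * int i)" for i
  proof -
    have "[(s - t) * int i = 0] (mod int N)"
      using st by (metis cong_diff_iff_cong_0 cong_mult_self_right cong_scalar_right mult_zero_left)
    then have "q powi (s * int i - t * int i) = 1"
      by (simp add: primitive_root_power_int_eq_1_iff[OF primitive] left_diff_distrib)
    then show ?thesis by (simp add: power_int_diff)
  qed
  then show "e s = e t" by (simp add: e_def)
qed

lemma sum_e: "(\<Oplus>t\<in>{0..<int N}. e t) = \<one>"
proof -
  have N0: "0 < N" using N_ge_2 by simp
  have "(\<Oplus>t\<in>{0..<int N}. e t) =
      (1 / of_nat N) \<star> (\<Oplus>t\<in>{0..<int N}. \<Oplus>i\<in>{..<N}. (q powi (t * int i)) \<star> g [^] i)"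
    unfolding e_def by (subst smul_finsum) (auto intro!: finsum_closed)
  also have "(\<Oplus>t\<in>{0..<int N}. \<Oplus>i\<in>{..<N}. (q powi (t * int i)) \<star> g [^] i) =
      (\<Oplus>i\<in>{..<N}. \<Oplus>t\<in>{0..<int N}. (q powi (t * int i)) \<star> g [^] i)"
    by (intro finsum_swap) auto
  also have "\<dots> = (\<Oplus>i\<in>{..<N}. if 0 = i then of_nat N \<star> g [^] i else \<zero>)"
  proof (intro finsum_cong')
    fix i assume i: "i \<in> {..<N}"
    have "(\<Oplus>t\<in>{0..<int N}. (q powi (t * int i)) \<star> g [^] i) =
        (\<Sum>t\<in>{0..<int N}. q powi (t * int i)) \<star> g [^] i"
      by (intro sum_smul) auto
    also have "(\<Sum>t\<in>{0..<int N}. q powi (t * int i)) = (\<Sum>j<N. q powi (int i * int j))"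
      by (intro sum.reindex_bij_witness[where i = int and j = nat]) (auto simp: mult.commute)
    also have "\<dots> = (if 0 = i then of_nat N else 0)"
      using i unfolding sum_powers_primitive_root[OF primitive]
      by (auto simp: cong_0_iff zdvd_not_zless dest: zdvd_imp_le)
    finally show "(\<Oplus>t\<in>{0..<int N}. (q powi (t * int i)) \<star> g [^] i) =
        (if 0 = i then of_nat N \<star> g [^] i else \<zero>)"
      by simp
  qed auto
  also have "\<dots> = of_nat N \<star> g [^] (0::nat)"
    by (intro add.finprod_singleton) (use N0 in auto)
  finally show ?thesis by simp
qed

lemma e_x: "e t \<otimes> x = x \<otimes> e (t + 1)"
proof -
  have pow: "g [^] i \<otimes> x = (q ^ i) \<star> (x \<otimes> g [^] i)" for i :: nat
  proof (induction i)
    case (Suc i)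
    have "g [^] Suc i \<otimes> x = g [^] i \<otimes> (g \<otimes> x)"
      by (simp add: m_assoc)
    also have "\<dots> = q \<star> ((g [^] i \<otimes> x) \<otimes> g)"
      by (simp add: g_x m_assoc)
    finally show ?case
      by (simp add: Suc m_assoc)
  qed simp
  have "e t \<otimes> x = (1 / of_nat N) \<star> (\<Oplus>i\<in>{..<N}. (q powi (t * int i)) \<star> g [^] i \<otimes> x)"
    unfolding e_def by (subst smul_mult_left) (auto intro!: finsum_closed simp: finsum_ldistr Pi_def)
  also have "(\<Oplus>i\<in>{..<N}. (q powi (t * int i)) \<star> g [^] i \<otimes> x) =
      (\<Oplus>i\<in>{..<N}. x \<otimes> (q powi ((t + 1) * int i)) \<star> g [^] i)"
  proof (intro finsum_cong')
    fix i :: nat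
    have "q powi (t * int i) * q ^ i = q powi ((t + 1) * int i)"
      by (simp add: algebra_simps power_int_add)
    then show "(q powi (t * int i)) \<star> g [^] i \<otimes> x = x \<otimes> (q powi ((t + 1) * int i)) \<star> g [^] i"
      by (simp add: pow)
  qed auto
  also have "\<dots> = x \<otimes> (\<Oplus>i\<in>{..<N}. (q powi ((t + 1) * int i)) \<star> g [^] i)"
    by (intro finsum_rdistr[symmetric]) auto
  finally show ?thesis
    unfolding e_def by (subst smul_mult_right) (auto intro!: finsum_closed)
qed

lemma e_x_pow: "e t \<otimes> x [^] i = x [^] i \<otimes> e (t + int i)" for i :: nat
proof (induction i)
  case (Suc i)
  have "e t \<otimes> x [^] Suc i = (e t \<otimes> x [^] i) \<otimes> x"
    by (simp add: m_assoc)
  also have "\<dots> = x [^] i \<otimes> (e (t + int i) \<otimes> x)"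
    by (simp add: Suc m_assoc)
  finally show ?case
    by (simp add: e_x m_assoc add_ac)
qed simp

lemma x_pow_large: "N \<le> i \<Longrightarrow> x [^] i = \<zero>" for i :: nat
  using nat_pow_mult[of x N "i - N"] by (simp add: x_pow_N)

lemma unit_in_carrier [simp]: "\<iota> c \<in> carrier A"
  by (rule unit_closed)

lemma R_subset: "R \<subseteq> carrier A"
  unfolding R_def by (rule generate_ring_incl) auto

lemma R_closed [simp, intro]: "r \<in> R \<Longrightarrow> r \<in> carrier A"
  using R_subset by blast

lemma R_add: "\<lbrakk>r \<in> R; r' \<in> R\<rbrakk> \<Longrightarrow> r \<oplus> r' \<in> R"
  and R_mult: "\<lbrakk>r \<in> R; r' \<in> R\<rbrakk> \<Longrightarrow> r \<otimes> r' \<in> R"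
  and R_one: "\<one> \<in> R" and R_zero: "\<zero> \<in> R" and R_x: "x \<in> R" and R_unit: "\<iota> c \<in> R"
  unfolding R_def by (auto intro: generate_ring.intros zero_in_generate)

lemma R_smul: "r \<in> R \<Longrightarrow> c \<star> r \<in> R"
  by (simp add: smul_def R_mult R_unit)

lemma R_x_pow: "x [^] i \<in> R" for i :: nat
  by (induction i) (auto intro: R_one R_mult R_x)

text \<open>\<open>R\<close> is spanned by the powers of \<open>x\<close>. The set of \<open>r\<close> for which \<open>w \<mapsto> r w\<close> preserves the
  property is a subring containing the generators of \<open>R\<close>, which is why closure under multiplication
  by \<open>x\<close> alone suffices.\<close>

lemma R_induct [consumes 1, case_names zero one x add smul]:
  assumes r: "r \<in> R"
    and zero: "P \<zero>" and one: "P \<one>"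
    and x: "\<And>w. \<lbrakk>w \<in> R; P w\<rbrakk> \<Longrightarrow> P (x \<otimes> w)"
    and add: "\<And>w z. \<lbrakk>w \<in> R; z \<in> R; P w; P z\<rbrakk> \<Longrightarrow> P (w \<oplus> z)"
    and smul: "\<And>c w. \<lbrakk>w \<in> R; P w\<rbrakk> \<Longrightarrow> P (c \<star> w)"
  shows "P r"
proof -
  have "\<forall>w. w \<in> R \<and> P w \<longrightarrow> r \<otimes> w \<in> R \<and> P (r \<otimes> w)"
    using r unfolding R_def
  proof (induction r rule: generate_ring.induct)
    case one
    then show ?case by (auto simp flip: R_def)
  next
    case (incl h)
    then show ?case using x smul by (auto simp: R_mult R_x R_smul simp flip: R_def smul_def)
  next
    case (a_inv h)
    then have "h \<in> carrier A" using R_closed by (simp add: R_def)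
    then have "\<ominus> h \<otimes> w = (- 1) \<star> (h \<otimes> w)" if "w \<in> R" for w
      using that by (simp add: l_minus smul_minus_one)
    then show ?case using a_inv smul R_smul by (auto simp flip: R_def)
  next
    case (eng_add h1 h2)
    then have "h1 \<in> carrier A" "h2 \<in> carrier A" using R_closed by (simp_all add: R_def)
    then show ?case using eng_add add R_add by (auto simp: l_distr simp flip: R_def)
  next
    case (eng_mult h1 h2)
    then have "h1 \<in> carrier A" "h2 \<in> carrier A" using R_closed by (simp_all add: R_def)
    then show ?case using eng_mult by (auto simp: m_assoc simp flip: R_def)
  qed
  then show ?thesis
    using one R_one r by force
qed

text \<open>Iterating this splitting reads off the coefficients of \<open>r\<close> one at a time.\<close>

lemma R_decompose:
  assumes "r \<in> R"
  obtains c r' where "r' \<in> R" "r = c \<star> \<one> \<oplus> x \<otimes> r'"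
proof -
  have "\<exists>c. \<exists>r'\<in>R. r = c \<star> \<one> \<oplus> x \<otimes> r'"
    using assms
  proof (induction rule: R_induct)
    case zero
    then show ?case by (intro exI[of _ 0] bexI[of _ \<zero>]) (auto intro: R_zero)
  next
    case one
    then show ?case by (intro exI[of _ 1] bexI[of _ \<zero>]) (auto intro: R_zero)
  next
    case (x w)
    then show ?case by (intro exI[of _ 0] bexI[of _ w]) auto
  next
    case (add w z)
    then obtain c d r s where "r \<in> R" "s \<in> R" "w = c \<star> \<one> \<oplus> x \<otimes> r" "z = d \<star> \<one> \<oplus> x \<otimes> s"
      by blast
    then show ?case
      by (intro exI[of _ "c + d"] bexI[of _ "r \<oplus> s"])
        (auto simp: smul_add_left r_distr a_ac intro: R_add)
  next
    case (smul d w)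
    then obtain c r where "r \<in> R" "w = c \<star> \<one> \<oplus> x \<otimes> r"
      by blast
    then show ?case
      by (intro exI[of _ "d * c"] bexI[of _ "d \<star> r"]) (auto simp: smul_add_right intro: R_smul)
  qed
  then show ?thesis using that by blast
qed

lemma carrier_induct [consumes 1, case_names zero one g x add smul]:
  assumes y: "y \<in> carrier A"
    and zero: "P \<zero>" and one: "P \<one>"
    and g: "\<And>w. \<lbrakk>w \<in> carrier A; P w\<rbrakk> \<Longrightarrow> P (g \<otimes> w)"
    and x: "\<And>w. \<lbrakk>w \<in> carrier A; P w\<rbrakk> \<Longrightarrow> P (x \<otimes> w)"
    and add: "\<And>w z. \<lbrakk>w \<in> carrier A; z \<in> carrier A; P w; P z\<rbrakk> \<Longrightarrow> P (w \<oplus> z)"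
    and smul: "\<And>c w. \<lbrakk>w \<in> carrier A; P w\<rbrakk> \<Longrightarrow> P (c \<star> w)"
  shows "P y"
proof -
  have "carrier A \<subseteq> {w \<in> carrier A. P w}"
    by (rule generation) (auto simp: k_subspace_def zero one g x add smul)
  then show ?thesis using y by blast
qed

text \<open>Moving \<open>e\<^sub>t\<close> to the right past \<open>g\<close> produces a scalar, and past \<open>x\<close> it becomes \<open>e\<^bsub>t+1\<^esub>\<close>; therefore the
  claim has to be proved for all \<open>t\<close> at once.\<close>

lemma e_mult_in_eR:
  assumes "y \<in> carrier A"
  shows "\<exists>r\<in>R. e t \<otimes> y = e t \<otimes> r"
  using assms
proof (induction arbitrary: t rule: carrier_induct)
  case zero
  then show ?case using R_zero by blast
next
  case one
  then show ?case using R_one by blast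
next
  case (g w)
  then obtain r where r: "r \<in> R" "e t \<otimes> w = e t \<otimes> r" by blast
  have "e t \<otimes> g = (q powi (- t)) \<star> e t"
    by (rule e_g)
  then have "e t \<otimes> (g \<otimes> w) = e t \<otimes> ((q powi (- t)) \<star> r)"
    using r g by (simp flip: m_assoc)
  then show ?case using r R_smul by blast
next
  case (x w)
  then obtain r where r: "r \<in> R" "e (t + 1) \<otimes> w = e (t + 1) \<otimes> r" by blast
  have "e t \<otimes> (x \<otimes> w) = x \<otimes> (e (t + 1) \<otimes> w)"
    using x e_x[of t] by (simp flip: m_assoc)
  also have "\<dots> = e t \<otimes> (x \<otimes> r)"
    using r e_x[of t] by (simp flip: m_assoc)
  finally show ?case using r R_mult R_x by blast
next
  case (add w z)
  then show ?case by (metis R_add R_closed e_closed r_distr)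
next
  case (smul c w)
  then show ?case by (metis R_smul R_closed e_closed smul_mult_right)
qed

lemma M_iff: "y \<in> M s t \<longleftrightarrow> (\<exists>r\<in>R. y = e s \<otimes> x [^] t \<otimes> r)"
  by (auto simp: M_def l_coset_def)

lemma M_0: "M s 0 = {y \<in> carrier A. e s \<otimes> y = y}"
proof (intro equalityI subsetI)
  fix y assume "y \<in> M s 0"
  then show "y \<in> {y \<in> carrier A. e s \<otimes> y = y}"
    by (auto simp: M_iff e_e simp flip: m_assoc)
next
  fix y assume "y \<in> {y \<in> carrier A. e s \<otimes> y = y}"
  then show "y \<in> M s 0"
    using e_mult_in_eR[of y s] by (auto simp: M_iff)
qed

end

section \<open>Orthogonals of the modules for an abstract pairing\<close>

lemma left_orth_eq_right_orth_flip: "left_orth A F W = right_orth A (\<lambda>y z. F z y) W"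
  by (simp add: left_orth_def right_orth_def)

text \<open>If \<open>b\<close> is adjoint to \<open>a\<close>, then \<open>z\<close> is orthogonal to \<open>a W\<close> exactly if \<open>b z\<close> is orthogonal to \<open>W\<close>.\<close>

lemma (in ring) right_orth_l_coset:
  assumes b: "b \<in> Units R" and W: "W \<subseteq> carrier R"
    and adj: "\<And>y z. \<lbrakk>y \<in> W; z \<in> carrier R\<rbrakk> \<Longrightarrow> F (a \<otimes> y) z = F y (b \<otimes> z)"
  shows "right_orth R F (a <# W) = inv b <# right_orth R F W"
proof (intro equalityI subsetI)
  have bR: "b \<in> carrier R" using b by (rule Units_closed)
  fix z
  { assume z: "z \<in> right_orth R F (a <# W)"
    then have zR: "z \<in> carrier R" by (simp add: right_orth_def)
    have "b \<otimes> z \<in> right_orth R F W"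
      using z bR by (auto simp: right_orth_def l_coset_def adj)
    moreover have "z = inv b \<otimes> (b \<otimes> z)"
      using b bR zR by (simp flip: m_assoc)
    ultimately show "z \<in> inv b <# right_orth R F W"
      unfolding l_coset_def by blast }
  { assume "z \<in> inv b <# right_orth R F W"
    then obtain v where v: "v \<in> right_orth R F W" "z = inv b \<otimes> v"
      by (auto simp: l_coset_def)
    then have vR: "v \<in> carrier R" by (simp add: right_orth_def)
    have "b \<otimes> z = v"
      using b bR vR v(2) by (simp flip: m_assoc)
    moreover have "z \<in> carrier R" using b v vR by simp
    ultimately show "z \<in> right_orth R F (a <# W)"
      using v(1) by (auto simp: right_orth_def l_coset_def adj) }
qed

context taft_presentation
begin

lemma cong_iff_mod: "u \<in> {0..<int N} \<Longrightarrow> [t = u] (mod int N) \<longleftrightarrow> u = t mod int N"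
  by (auto simp: cong_def)

lemma mod_N_range: "t mod int N \<in> {0..<int N}"
  using N_ge_2 by simp

lemma e_decompose: "y \<in> carrier A \<Longrightarrow> (\<Oplus>t\<in>{0..<int N}. e t \<otimes> y) = y"
  by (simp add: sum_e flip: finsum_ldistr)

text \<open>The elements \<open>e\<^sub>t x\<^sup>k\<close> span \<open>A\<close>, by \<open>y = \<Sum> e\<^sub>t y\<close> and \<open>e\<^sub>t y \<in> e\<^sub>t R\<close>.\<close>

lemma basis_induct [consumes 1, case_names basis add smul]:
  assumes y: "y \<in> carrier A"
    and basis: "\<And>t k. P (e t \<otimes> x [^] (k::nat))"
    and add: "\<And>w z. \<lbrakk>w \<in> carrier A; z \<in> carrier A; P w; P z\<rbrakk> \<Longrightarrow> P (w \<oplus> z)"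
    and smul: "\<And>c w. \<lbrakk>w \<in> carrier A; P w\<rbrakk> \<Longrightarrow> P (c \<star> w)"
  shows "P y"
proof -
  have zero: "P \<zero>"
    using smul[OF _ basis[of 0 0], of 0] by simp
  have "P (e t \<otimes> x [^] k \<otimes> r)" if "r \<in> R" for t r and k :: nat
    using that
  proof (induction arbitrary: k rule: R_induct)
    case (x w)
    then show ?case using x.IH[of "Suc k"] by (simp add: m_assoc)
  qed (simp_all add: zero basis add smul r_distr)
  from this[of _ _ 0] have eR: "P (e t \<otimes> y)" for t
    using e_mult_in_eR[OF y, of t] by auto
  have "P (\<Oplus>t\<in>T. e t \<otimes> y)" if "finite T" for T
    using that
    by induction (simp_all add: zero y eR add Pi_def finsum_closed)
  then show ?thesis
    using e_decompose[OF y] by (metis finite_atLeastLessThan_int)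
qed

lemma M_N: "M s N = {\<zero>}"
  using R_one by (auto simp: M_iff x_pow_N)

lemma M_subset: "M s k \<subseteq> carrier A"
  by (auto simp: M_iff)

lemma e_mult_M: "v \<in> M s k \<Longrightarrow> e s \<otimes> v = v"
  by (auto simp: M_iff e_e simp flip: m_assoc)

lemma zero_in_M: "\<zero> \<in> M s k"
  using R_zero by (auto simp: M_iff intro!: bexI[of _ \<zero>])

text \<open>Since \<open>N\<^bsub>t,0\<^esub> = e\<^sub>t A\<close>, this is the Peirce decomposition of \<open>A\<close> without the summand \<open>e\<^sub>u A\<close>.\<close>

lemma annihilator_direct_sum:
  "is_direct_sum A {y \<in> carrier A. e u \<otimes> y = \<zero>}
     {t. 0 \<le> t \<and> t \<le> int N - 1 \<and> \<not> [t = u] (mod int N)} (\<lambda>t. M t 0)"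
proof -
  define I where "I = {t. 0 \<le> t \<and> t \<le> int N - 1 \<and> \<not> [t = u] (mod int N)}"
  have I: "I = {0..<int N} - {u mod int N}"
    using cong_iff_mod by (auto simp: I_def cong_sym_eq[of _ u])
  have fin: "finite I" by (simp add: I)
  have comp: "e i \<otimes> finsum A v I = (if i \<in> I then v i else \<zero>)"
    if v: "v \<in> (\<Pi> t\<in>I. M t 0)" and i: "i \<in> {0..<int N}" for v i
  proof -
    have vc: "v t \<in> carrier A" "e t \<otimes> v t = v t" if "t \<in> I" for t
      using v that by (auto simp: M_0)
    have "e i \<otimes> finsum A v I = (\<Oplus>t\<in>I. e i \<otimes> v t)"
      using fin vc by (simp add: finsum_rdistr Pi_def)
    also have "\<dots> = (\<Oplus>t\<in>I. if i = t then v t else \<zero>)"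
    proof (rule finsum_cong')
      fix t assume t: "t \<in> I"
      have "e i \<otimes> v t = (e i \<otimes> e t) \<otimes> v t"
        using vc[OF t] by (simp add: m_assoc)
      moreover have "[i = t] (mod int N) \<longleftrightarrow> i = t"
        using t i cong_iff_mod[of t i] by (auto simp: I)
      ultimately show "e i \<otimes> v t = (if i = t then v t else \<zero>)"
        using vc[OF t] by (auto simp: e_e)
    qed (use vc in auto)
    also have "\<dots> = (if i \<in> I then v i else \<zero>)"
    proof (cases "i \<in> I")
      case True
      then show ?thesis
        using add.finprod_singleton[OF True fin, of v] vc by (simp add: Pi_def)
    next
      case False
      then show ?thesis by (auto intro: add.finprod_one_eqI)
    qed
    finally show ?thesis .
  qed
  have closed: "finsum A v I \<in> carrier A" if "v \<in> (\<Pi> t\<in>I. M t 0)" for v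
    using that M_subset by (intro finsum_closed) blast
  have "{y \<in> carrier A. e u \<otimes> y = \<zero>} = {finsum A v I | v. v \<in> (\<Pi> t\<in>I. M t 0)}"
  proof (intro equalityI subsetI)
    fix y assume "y \<in> {y \<in> carrier A. e u \<otimes> y = \<zero>}"
    then have y: "y \<in> carrier A" "e u \<otimes> y = \<zero>" by auto
    have "e t \<otimes> y = \<zero>" if "t \<in> {0..<int N} - I" for t
    proof -
      have "[t = u] (mod int N)" using that by (auto simp: I_def)
      then show ?thesis using y e_cong[of t u] by simp
    qed
    then have "(\<Oplus>t\<in>I. e t \<otimes> y) = (\<Oplus>t\<in>{0..<int N}. e t \<otimes> y)"
      using y by (intro add.finprod_mono_neutral_cong_left) (auto simp: I)
    then have "y = (\<Oplus>t\<in>I. e t \<otimes> y)"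
      by (simp add: e_decompose y)
    moreover have "(\<lambda>t. e t \<otimes> y) \<in> (\<Pi> t\<in>I. M t 0)"
      using y by (auto simp: M_0 e_e simp flip: m_assoc)
    ultimately show "y \<in> {finsum A v I | v. v \<in> (\<Pi> t\<in>I. M t 0)}"
      by blast
  next
    fix y assume "y \<in> {finsum A v I | v. v \<in> (\<Pi> t\<in>I. M t 0)}"
    then obtain v where v: "v \<in> (\<Pi> t\<in>I. M t 0)" "y = finsum A v I" by blast
    have "e u = e (u mod int N)" by (rule e_cong) simp
    then show "y \<in> {y \<in> carrier A. e u \<otimes> y = \<zero>}"
      using comp[OF v(1) mod_N_range[of u]] closed[OF v(1)] v(2) by (simp add: I)
  qed
  moreover have "\<forall>i\<in>I. v i = \<zero>"
    if v: "v \<in> (\<Pi> t\<in>I. M t 0)" and 0: "finsum A v I = \<zero>" for v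
  proof
    fix i assume i: "i \<in> I"
    then have "i \<in> {0..<int N}" by (simp add: I)
    then show "v i = \<zero>" using comp[OF v, of i] i 0 by simp
  qed
  ultimately show ?thesis
    unfolding is_direct_sum_def I_def[symmetric] by blast
qed

text \<open>The two components of \<open>y\<close> are \<open>y - e\<^sub>u y\<close> and \<open>e\<^sub>u y\<close>.\<close>

lemma preimage_direct_sum2:
  "is_direct_sum2 A {y \<in> carrier A. e u \<otimes> y \<in> M u k} {y \<in> carrier A. e u \<otimes> y = \<zero>} (M u k)"
  unfolding is_direct_sum2_def
proof
  show "{y \<in> carrier A. e u \<otimes> y \<in> M u k} = {y \<in> carrier A. e u \<otimes> y = \<zero>} <+>\<^bsub>A\<^esub> M u k"
  proof (intro equalityI subsetI)
    fix y assume "y \<in> {y \<in> carrier A. e u \<otimes> y \<in> M u k}"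
    then have y: "y \<in> carrier A" "e u \<otimes> y \<in> M u k" by auto
    have "e u \<otimes> (e u \<otimes> y) = e u \<otimes> y" using y by (simp add: e_e flip: m_assoc)
    then have "e u \<otimes> (y \<oplus> \<ominus> (e u \<otimes> y)) = \<zero>"
      using y by (simp add: r_distr r_minus r_neg)
    moreover have "y = (y \<oplus> \<ominus> (e u \<otimes> y)) \<oplus> e u \<otimes> y"
      using y by (simp add: a_assoc l_neg)
    ultimately show "y \<in> {y \<in> carrier A. e u \<otimes> y = \<zero>} <+>\<^bsub>A\<^esub> M u k"
      unfolding set_add_def' using y
      by (intro UN_I[of "y \<oplus> \<ominus> (e u \<otimes> y)"] UN_I[of "e u \<otimes> y"]) auto
  next
    fix y assume "y \<in> {y \<in> carrier A. e u \<otimes> y = \<zero>} <+>\<^bsub>A\<^esub> M u k"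
    then obtain v w where "v \<in> carrier A" "e u \<otimes> v = \<zero>" "w \<in> M u k" "y = v \<oplus> w"
      by (auto simp: set_add_def')
    moreover from this have "w \<in> carrier A" using M_subset by blast
    ultimately show "y \<in> {y \<in> carrier A. e u \<otimes> y \<in> M u k}"
      by (simp add: r_distr e_mult_M)
  qed
  show "{y \<in> carrier A. e u \<otimes> y = \<zero>} \<inter> M u k = {\<zero>}"
    using e_mult_M zero_in_M by fastforce
qed

text \<open>The property of the form \<open>\<langle>y, z\<rangle> = \<lambda>(z S(y))\<close> that determines its orthogonals. It is invariant under
  exchanging the arguments, although the form itself is not symmetric.\<close>

definition taft_pairing :: "('a \<Rightarrow> 'a \<Rightarrow> 'k) \<Rightarrow> bool" where
  "taft_pairing F \<longleftrightarrow>
     (\<forall>u\<in>carrier A. k_functional (F u)) \<and> (\<forall>v\<in>carrier A. k_functional (\<lambda>u. F u v)) \<and>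
     (\<forall>s t. \<forall>i j :: nat. F (e s \<otimes> x [^] i) (e t \<otimes> x [^] j) \<noteq> 0 \<longleftrightarrow>
        i + j = N - 1 \<and> [s + t = 1] (mod int N))"

lemma taft_pairing_flip: "taft_pairing F \<Longrightarrow> taft_pairing (\<lambda>y z. F z y)"
  by (auto simp: taft_pairing_def add.commute)

text \<open>Only the component \<open>e\<^bsub>1-s\<^esub> y = e\<^bsub>1-s\<^esub> r\<close> pairs with \<open>N\<^bsub>s,m\<^esub>\<close>. Pairing it with \<open>e\<^sub>s x\<^bsup>N-1-k\<^esup>\<close> detects the
  coefficient of \<open>x\<^sup>k\<close> in \<open>r\<close> once the lower ones are known to vanish. The exponents \<open>N - 1 - k\<close>
  that are at least \<open>m\<close> belong to \<open>k < N - m\<close>, so orthogonality says \<open>r \<in> x\<^bsup>N-m\<^esup> R\<close>.\<close>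

lemma taft_pairing_right_orth:
  assumes F: "taft_pairing F" and m: "m \<le> N"
  shows "right_orth A F (M s m) = {y \<in> carrier A. e (1 - s) \<otimes> y \<in> M (1 - s) (N - m)}"
proof -
  have lin: "k_functional (F u)" if "u \<in> carrier A" for u
    using F that by (simp add: taft_pairing_def)
  have lin': "k_functional (\<lambda>u. F u v)" if "v \<in> carrier A" for v
    using F that by (simp add: taft_pairing_def)
  have basis: "F (e s \<otimes> x [^] i) (e t \<otimes> x [^] j) \<noteq> 0 \<longleftrightarrow> i + j = N - 1 \<and> [s + t = 1] (mod int N)"
    for s t and i j :: nat
    using F by (simp add: taft_pairing_def)
  have vanish: "F (e s \<otimes> x [^] i) (e t \<otimes> x [^] k \<otimes> r) = 0"
    if r: "r \<in> R" and "\<not> [s + t = 1] (mod int N) \<or> i + k \<ge> N" for t r and i k :: nat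
    using that
  proof (induction arbitrary: k rule: R_induct)
    case one
    then show ?case using basis[of s i t k] N_ge_2 by auto
  next
    case (x w)
    then show ?case using x.IH[of "Suc k"] by (auto simp: m_assoc)
  qed (simp_all add: k_functional_zero[OF lin] k_functional_add[OF lin] k_functional_smul[OF lin] r_distr)
  have orth_iff: "(\<forall>w\<in>M s m. F w y = 0) \<longleftrightarrow> (\<forall>i\<ge>m. F (e s \<otimes> x [^] i) y = 0)"
    if y: "y \<in> carrier A" for y
  proof
    assume 0: "\<forall>w\<in>M s m. F w y = 0"
    show "\<forall>i\<ge>m. F (e s \<otimes> x [^] i) y = 0"
    proof (intro allI impI)
      fix i assume "m \<le> i"
      then have "e s \<otimes> x [^] i = e s \<otimes> x [^] m \<otimes> x [^] (i - m)"
        by (simp add: m_assoc nat_pow_mult)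
      then show "F (e s \<otimes> x [^] i) y = 0"
        using 0 R_x_pow by (metis M_iff)
    qed
  next
    assume 0: "\<forall>i\<ge>m. F (e s \<otimes> x [^] i) y = 0"
    have "F (e s \<otimes> x [^] i \<otimes> r) y = 0" if "r \<in> R" "i \<ge> m" for r and i :: nat
      using that
    proof (induction arbitrary: i rule: R_induct)
      case one
      then show ?case using 0 by simp
    next
      case (x w)
      then show ?case using x.IH[of "Suc i"] by (simp add: m_assoc)
    qed (use y in \<open>simp_all add: k_functional_zero[OF lin'] k_functional_add[OF lin']
          k_functional_smul[OF lin'] r_distr\<close>)
    then show "\<forall>w\<in>M s m. F w y = 0"
      by (auto simp: M_iff)
  qed
  have component: "F (e s \<otimes> x [^] i) y = F (e s \<otimes> x [^] i) (e (1 - s) \<otimes> y)"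
    if y: "y \<in> carrier A" for y and i :: nat
  proof -
    let ?u = "(1 - s) mod int N"
    have "F (e s \<otimes> x [^] i) (e t \<otimes> y) = 0" if "t \<in> {0..<int N} - {?u}" for t
    proof -
      have "\<not> [s + t = 1] (mod int N)"
        using that cong_iff_mod[of t "1 - s"]
        by (auto simp: cong_iff_dvd_diff algebra_simps dvd_diff_commute)
      moreover obtain r where "r \<in> R" "e t \<otimes> y = e t \<otimes> x [^] (0::nat) \<otimes> r"
        using e_mult_in_eR[OF y, of t] by auto
      ultimately show ?thesis using vanish[of r t i 0] by simp
    qed
    then have "(\<Sum>t\<in>{0..<int N}. F (e s \<otimes> x [^] i) (e t \<otimes> y)) = F (e s \<otimes> x [^] i) (e ?u \<otimes> y)"
      using mod_N_range by (subst sum.remove[of _ ?u]) auto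
    moreover have "F (e s \<otimes> x [^] i) y = (\<Sum>t\<in>{0..<int N}. F (e s \<otimes> x [^] i) (e t \<otimes> y))"
      using y by (subst e_decompose[OF y, symmetric], subst k_functional_finsum[OF lin]) auto
    moreover have "e ?u = e (1 - s)" by (rule e_cong) simp
    ultimately show ?thesis by simp
  qed
  have "(\<forall>w\<in>M s m. F w y = 0) \<longleftrightarrow> e (1 - s) \<otimes> y \<in> M (1 - s) (N - m)"
    if y: "y \<in> carrier A" for y
  proof
    assume "\<forall>w\<in>M s m. F w y = 0"
    then have 0: "F (e s \<otimes> x [^] i) (e (1 - s) \<otimes> y) = 0" if "i \<ge> m" for i :: nat
      using that orth_iff[OF y] component[OF y] by metis
    \<comment> \<open>Raise the known power of \<open>x\<close> one step at a time, up to \<open>N - m\<close>.\<close>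
    have "e (1 - s) \<otimes> y \<in> M (1 - s) k" if "k \<le> N - m" for k
      using that
    proof (induction k)
      case 0
      then show ?case using y by (simp add: M_0 e_e flip: m_assoc)
    next
      case (Suc k)
      then obtain r where r: "r \<in> R" "e (1 - s) \<otimes> y = e (1 - s) \<otimes> x [^] k \<otimes> r"
        by (auto simp: M_iff)
      obtain c r' where r': "r' \<in> R" "r = c \<star> \<one> \<oplus> x \<otimes> r'"
        using R_decompose[OF r(1)] .
      \<comment> \<open>The test vector \<open>e\<^sub>s x\<^sup>i\<close> sees the coefficient \<open>c\<close> of \<open>x\<^sup>k\<close> and kills every higher power.\<close>
      define i where "i = N - 1 - k"
      have i: "i \<ge> m" "i + k = N - 1" "i + Suc k \<ge> N"
        using Suc.prems by (auto simp: i_def)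
      have split: "e (1 - s) \<otimes> y = c \<star> (e (1 - s) \<otimes> x [^] k) \<oplus> e (1 - s) \<otimes> x [^] Suc k \<otimes> r'"
        using r' by (simp add: r(2) r_distr m_assoc)
      have "0 = c * F (e s \<otimes> x [^] i) (e (1 - s) \<otimes> x [^] k) +
          F (e s \<otimes> x [^] i) (e (1 - s) \<otimes> x [^] Suc k \<otimes> r')"
        using 0[OF i(1)] r' unfolding split
        by (subst (asm) k_functional_add[OF lin]) (simp_all add: k_functional_smul[OF lin])
      also have "F (e s \<otimes> x [^] i) (e (1 - s) \<otimes> x [^] Suc k \<otimes> r') = 0"
        using vanish[OF r'(1), of "1 - s" i "Suc k"] i(3) by blast
      finally have "c = 0"
        using basis[of s i "1 - s" k] i(2) by simp
      then have "e (1 - s) \<otimes> y = e (1 - s) \<otimes> x [^] Suc k \<otimes> r'"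
        using split r' by simp
      then show ?case using r'(1) M_iff by blast
    qed
    then show "e (1 - s) \<otimes> y \<in> M (1 - s) (N - m)" by simp
  next
    assume "e (1 - s) \<otimes> y \<in> M (1 - s) (N - m)"
    then obtain r where r: "r \<in> R" "e (1 - s) \<otimes> y = e (1 - s) \<otimes> x [^] (N - m) \<otimes> r"
      by (auto simp: M_iff)
    have "F (e s \<otimes> x [^] i) (e (1 - s) \<otimes> y) = 0" if "i \<ge> m" for i :: nat
      unfolding r(2) using vanish[OF r(1), of "1 - s" i "N - m"] that by simp
    then show "\<forall>w\<in>M s m. F w y = 0"
      using orth_iff[OF y] component[OF y] by simp
  qed
  then show ?thesis by (auto simp: right_orth_def)
qed

end

section \<open>The form given by the integral and the antipode\<close>

locale taft_hopf_presentation =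
  taft_presentation A \<iota> g x q N + hopf_algebra A \<iota> \<Delta> \<epsilon> S
  for A :: "('a, 'b) ring_scheme" (structure) and \<iota> :: "'k::field \<Rightarrow> 'a"
    and g x :: 'a and q :: 'k and N :: nat
    and \<Delta> :: "'a \<Rightarrow> (('a \<Rightarrow> 'a \<Rightarrow> 'a) \<Rightarrow> 'a)" and \<epsilon> :: "'a \<Rightarrow> 'k" and S :: "'a \<Rightarrow> 'a" +
  fixes lam :: "'a \<Rightarrow> 'k"
  assumes comult_g: "\<Delta> g = pure_tensor A \<iota> g g"
    and comult_x: "\<Delta> x = pure_tensor A \<iota> g x \<oplus>\<^bsub>tensor_square A \<iota>\<^esub> pure_tensor A \<iota> x \<one>"
    and antipode_g: "S g = inv g"
    and antipode_x: "S x = \<ominus> (inv g \<otimes> x)"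
    and lam_linear: "k_functional lam"
    and lam_monomial: "\<And>m b :: nat. lam (x [^] m \<otimes> g [^] b) = (if m = N - 1 \<and> [b = 1] (mod N) then 1 else 0)"
begin

lemma g_Units: "g \<in> Units A"
proof -
  obtain n where n: "N = Suc n" using N_ge_2 by (cases N) auto
  have "g [^] n \<otimes> g = \<one>" using g_pow_N n by simp
  moreover have "g \<otimes> g [^] n = \<one>"
    using g_pow_N nat_pow_Suc2[OF g_closed, of n] n by simp
  ultimately show ?thesis
    unfolding Units_def by (auto intro!: bexI[of _ "g [^] n"])
qed

lemma inv_g_closed [simp]: "inv g \<in> carrier A"
  using g_Units by simp

lemma counit_x: "\<epsilon> x = 0"
proof -
  have "\<epsilon> (x [^] i) = \<epsilon> x ^ i" for i :: nat
  proof (induction i)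
    case 0
    then show ?case using counit_unit[of 1] by (simp add: unit_one)
  next
    case (Suc i)
    then show ?case by (simp add: counit_mult mult.commute)
  qed
  from this[of N] have "\<epsilon> x ^ N = 0"
    using counit_unit[of 0] by (simp add: x_pow_N unit_zero)
  then show ?thesis by simp
qed

lemma antipode_mult:
  assumes "y \<in> carrier A" "z \<in> carrier A"
  shows "S (y \<otimes> z) = S z \<otimes> S y"
  using assms(2,1)
proof (induction arbitrary: y rule: carrier_induct)
  case zero
  then show ?case using k_endo_zero[OF k_endo_antipode] by simp
next
  case one
  then show ?case by (simp add: antipode_one)
next
  case (g w)
  have "S (y \<otimes> (g \<otimes> w)) = S w \<otimes> S (y \<otimes> g)"
    using g g.IH[of "y \<otimes> g"] by (simp add: m_assoc)
  also have "\<dots> = (S w \<otimes> S g) \<otimes> S y"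
    using g by (simp add: antipode_mult_grouplike[OF g_Units comult_g] antipode_g m_assoc)
  also have "S w \<otimes> S g = S (g \<otimes> w)"
    using g.IH[of g] by simp
  finally show ?case .
next
  case (x w)
  have "S (y \<otimes> (x \<otimes> w)) = S w \<otimes> S (y \<otimes> x)"
    using x x.IH[of "y \<otimes> x"] by (simp add: m_assoc)
  also have "S (y \<otimes> x) = S x \<otimes> S y"
    using x antipode_mult_skew_primitive[OF g_Units x_closed counit_x comult_x] antipode_x by simp
  also have "S w \<otimes> (S x \<otimes> S y) = (S w \<otimes> S x) \<otimes> S y"
    using x by (simp add: m_assoc)
  also have "S w \<otimes> S x = S (x \<otimes> w)"
    using x.IH[of x] by simp
  finally show ?case .
next
  case (add w z)
  then show ?case by (simp add: r_distr l_distr k_endo_add[OF k_endo_antipode])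
next
  case (smul c w)
  then show ?case by (simp add: k_endo_smul[OF k_endo_antipode])
qed

lemma antipode_Units:
  assumes a: "a \<in> Units A"
  shows "S a \<in> Units A" and "inv (S a) = S (inv a)"
proof -
  have aA: "a \<in> carrier A" "inv a \<in> carrier A" using a by (auto intro: Units_closed)
  have "S a \<otimes> S (inv a) = \<one>"
    using antipode_mult[of "inv a" a] aA a by (simp add: antipode_one)
  moreover have "S (inv a) \<otimes> S a = \<one>"
    using antipode_mult[of a "inv a"] aA a by (simp add: antipode_one)
  ultimately have 1: "S a \<otimes> S (inv a) = \<one>" "S (inv a) \<otimes> S a = \<one>" .
  show "S a \<in> Units A"
    unfolding Units_def using 1 aA by (auto intro!: bexI[of _ "S (inv a)"])
  show "inv (S a) = S (inv a)"
    using 1 aA by (intro inv_char) auto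
qed

lemma inv_g_e: "inv g \<otimes> e t = (q powi t) \<star> e t"
proof -
  have "e t = g \<otimes> ((q powi t) \<star> e t)"
    by (simp add: g_e flip: power_int_add)
  then have "inv g \<otimes> e t = inv g \<otimes> (g \<otimes> ((q powi t) \<star> e t))" by simp
  also have "\<dots> = (q powi t) \<star> e t"
    using g_Units by (subst m_assoc[symmetric]) simp_all
  finally show ?thesis .
qed

text \<open>Applying \<open>S\<close> to \<open>e\<^sub>u g = q\<^bsup>-u\<^esup> e\<^sub>u\<close> shows that \<open>S(e\<^sub>u)\<close> lies in \<open>e\<^bsub>-u\<^esub> A\<close>. Multiplying
  \<open>1 = S(1) = \<Sum> S(e\<^sub>u)\<close> by \<open>e\<^bsub>-t\<^esub>\<close> then leaves the single term \<open>S(e\<^sub>t)\<close>.\<close>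

lemma antipode_e: "S (e t) = e (- t)"
proof -
  have eig: "g \<otimes> S (e u) = (q powi (- (- u))) \<star> S (e u)" for u
  proof -
    have "inv g \<otimes> S (e u) = (q powi (- u)) \<star> S (e u)"
      using antipode_mult[of "e u" g] by (simp add: e_g antipode_g k_endo_smul[OF k_endo_antipode])
    moreover have "S (e u) = g \<otimes> (inv g \<otimes> S (e u))"
      using g_Units by (simp flip: m_assoc)
    ultimately have "S (e u) = (q powi (- u)) \<star> (g \<otimes> S (e u))"
      by simp
    then have "(q powi u) \<star> S (e u) = (q powi u) \<star> (q powi (- u)) \<star> (g \<otimes> S (e u))"
      by simp
    then show ?thesis
      by (simp flip: power_int_add)
  qed
  let ?u = "t mod int N"
  have eu: "e (- t) \<otimes> S (e u) = (if ?u = u then S (e u) else \<zero>)" if "u \<in> {0..<int N}" for u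
  proof -
    have "[- t = - u] (mod int N) \<longleftrightarrow> ?u = u"
      using cong_iff_mod[OF that, of t] by (auto simp: cong_minus_minus_iff)
    then show ?thesis
      using e_eigenvector[OF _ eig, of u "- t"] by simp
  qed
  have "e (- t) = e (- t) \<otimes> S (\<Oplus>u\<in>{0..<int N}. e u)"
    by (simp add: sum_e antipode_one)
  also have "\<dots> = (\<Oplus>u\<in>{0..<int N}. e (- t) \<otimes> S (e u))"
    by (simp add: k_endo_finsum[OF k_endo_antipode] finsum_rdistr Pi_def)
  also have "\<dots> = (\<Oplus>u\<in>{0..<int N}. if ?u = u then S (e u) else \<zero>)"
    by (intro finsum_cong') (auto simp: eu)
  also have "\<dots> = S (e ?u)"
    using mod_N_range[of t] by (intro add.finprod_singleton) auto
  also have "e ?u = e t" by (rule e_cong) simp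
  finally show ?thesis by simp
qed

text \<open>The scalar is a power of \<open>q\<close> up to sign; only its being nonzero matters for orthogonality.\<close>

lemma antipode_basis:
  "\<exists>c. c \<noteq> 0 \<and> S (e s \<otimes> x [^] i) = c \<star> (e (- s - int i) \<otimes> x [^] i)" for i :: nat
proof (induction i)
  case 0
  show ?case by (intro exI[of _ 1]) (simp add: antipode_e)
next
  case (Suc i)
  define u where "u = - s - int i"
  obtain c where c: "c \<noteq> 0" "S (e s \<otimes> x [^] i) = c \<star> (e u \<otimes> x [^] i)"
    using Suc by (auto simp: u_def)
  have "x \<otimes> e u = e (u - 1) \<otimes> x" using e_x[of "u - 1"] by simp
  then have "inv g \<otimes> x \<otimes> e u = (q powi (u - 1)) \<star> (e (u - 1) \<otimes> x)"
    using inv_g_e[of "u - 1"] by (simp add: m_assoc flip: m_assoc[of "inv g" "e (u - 1)" x])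
  then have *: "inv g \<otimes> x \<otimes> (e u \<otimes> x [^] i) = (q powi (u - 1)) \<star> (e (u - 1) \<otimes> x [^] Suc i)"
    using nat_pow_Suc2[OF x_closed, of i] by (simp add: m_assoc[symmetric])
  have "S (e s \<otimes> x [^] Suc i) = S x \<otimes> S (e s \<otimes> x [^] i)"
    using antipode_mult[of "e s \<otimes> x [^] i" x] by (simp add: m_assoc)
  also have "\<dots> = (- (c * q powi (u - 1))) \<star> (e (u - 1) \<otimes> x [^] Suc i)"
    unfolding antipode_x c(2) by (simp add: smul_minus_one * del: nat_pow_Suc)
  finally show ?case
    using c(1) by (intro exI[of _ "- (c * q powi (u - 1))"]) (simp add: u_def algebra_simps)
qed

text \<open>Of the sum \<open>e\<^sub>t x\<^sup>j = N\<^sup>-\<^sup>1 \<Sum>\<^sub>i q\<^bsup>(t+j)i\<^esup> x\<^sup>j g\<^sup>i\<close> the integral sees the term \<open>i = 1\<close>, and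
  \<open>q\<^bsup>t+N-1\<^esup> = q\<^bsup>t-1\<^esup>\<close>.\<close>

lemma lam_basis:
  "lam (e t \<otimes> x [^] j) = (if j = N - 1 then q powi (t - 1) / of_nat N else 0)" for j :: nat
proof -
  have "e t \<otimes> x [^] j =
      (1 / of_nat N) \<star> (\<Oplus>i\<in>{..<N}. (q powi ((t + int j) * int i)) \<star> (x [^] j \<otimes> g [^] i))"
    unfolding e_x_pow unfolding e_def
    by (subst smul_mult_right) (auto intro!: finsum_closed simp: finsum_rdistr Pi_def)
  then have "lam (e t \<otimes> x [^] j) =
      1 / of_nat N * (\<Sum>i<N. q powi ((t + int j) * int i) * lam (x [^] j \<otimes> g [^] i))"
    by (simp add: k_functional_smul[OF lam_linear] k_functional_finsum[OF lam_linear] finsum_closed Pi_def)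
  also have "(\<Sum>i<N. q powi ((t + int j) * int i) * lam (x [^] j \<otimes> g [^] i)) =
      (\<Sum>i<N. if i = 1 then (if j = N - 1 then q powi (t + int j) else 0) else 0)"
    using N_ge_2 by (intro sum.cong) (auto simp: lam_monomial cong_def)
  also have "\<dots> = (if j = N - 1 then q powi (t + int (N - 1)) else 0)"
    using N_ge_2 by simp
  also have "q powi (t + int (N - 1)) = q powi (t - 1)"
  proof -
    have "q powi int N = 1"
      unfolding primitive_root_power_int_eq_1_iff[OF primitive] by (simp add: cong_def)
    moreover have "t + int (N - 1) = (t - 1) + int N" using N_ge_2 by simp
    ultimately show ?thesis by (simp only: power_int_add[OF disjI1[OF q_nonzero]] mult_1_right)
  qed
  finally show ?thesis by simp
qed

text \<open>With \<open>lam_mult_g\<close> below this says that \<open>\<lambda>(y z) = \<lambda>(\<nu>(z) y)\<close> for the automorphism \<open>\<nu>\<close>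
  that multiplies both generators by \<open>q\<close>.\<close>

lemma lam_mult_x:
  assumes "y \<in> carrier A"
  shows "lam (y \<otimes> x) = q * lam (x \<otimes> y)"
  using assms
proof (induction rule: basis_induct)
  case (basis t k)
  have "x \<otimes> (e t \<otimes> x [^] k) = e (t - 1) \<otimes> x [^] Suc k"
  proof -
    have "x \<otimes> e t = e (t - 1) \<otimes> x" using e_x[of "t - 1"] by simp
    then show ?thesis
      using nat_pow_Suc2[OF x_closed, of k] by (simp add: m_assoc[symmetric])
  qed
  moreover have "(e t \<otimes> x [^] k) \<otimes> x = e t \<otimes> x [^] Suc k"
    by (simp add: m_assoc)
  moreover have "lam (e t \<otimes> x [^] Suc k) = q * lam (e (t - 1) \<otimes> x [^] Suc k)"
  proof -
    have "q * q powi (t - 1 - 1) = q powi (t - 1)"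
      by (simp flip: power_int_add_1')
    then show ?thesis unfolding lam_basis by auto
  qed
  ultimately show ?case by (simp only:)
qed (simp_all add: l_distr r_distr k_functional_add[OF lam_linear] k_functional_smul[OF lam_linear]
    distrib_left)

lemma lam_mult_g:
  assumes "y \<in> carrier A"
  shows "lam (y \<otimes> g) = q * lam (g \<otimes> y)"
  using assms
proof (induction rule: basis_induct)
  case (basis t k)
  have "g \<otimes> (e t \<otimes> x [^] k) = (q powi (- t)) \<star> (e t \<otimes> x [^] k)"
    by (simp add: g_e flip: m_assoc)
  moreover have "(e t \<otimes> x [^] k) \<otimes> g = (q powi (- (t + int k))) \<star> (e t \<otimes> x [^] k)"
    unfolding e_x_pow by (simp add: m_assoc e_g)
  moreover have "q powi (- (t + int (N - 1))) = q * q powi (- t)"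
  proof -
    have "q powi (- (t + int (N - 1)) - (1 - t)) = 1"
      using N_ge_2 unfolding primitive_root_power_int_eq_1_iff[OF primitive] by (simp add: cong_def)
    then show ?thesis by (simp add: power_int_diff divide_simps power_int_minus mult.commute)
  qed
  ultimately show ?case
    by (simp add: lam_basis k_functional_smul[OF lam_linear])
qed (simp_all add: l_distr r_distr k_functional_add[OF lam_linear] k_functional_smul[OF lam_linear]
    distrib_left)

text \<open>On \<open>S(x) = -g\<^sup>-\<^sup>1 x\<close> the two factors \<open>q\<close> coming from \<open>x\<close> and from \<open>g\<^sup>-\<^sup>1\<close> cancel.\<close>

lemma lam_antipode_R:
  assumes "a \<in> R" "z \<in> carrier A"
  shows "lam (z \<otimes> S a) = lam (S a \<otimes> z)"
  using assms
proof (induction arbitrary: z rule: R_induct)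
  case zero
  then show ?case using k_endo_zero[OF k_endo_antipode] by simp
next
  case one
  then show ?case by (simp add: antipode_one)
next
  case (x w)
  have comm_x: "lam (y \<otimes> S x) = lam (S x \<otimes> y)" if y: "y \<in> carrier A" for y
  proof -
    let ?h = "inv g"
    have "lam (y \<otimes> (?h \<otimes> x)) = q * lam (x \<otimes> (y \<otimes> ?h))"
      using lam_mult_x[of "y \<otimes> ?h"] y by (simp add: m_assoc)
    also have "\<dots> = q * lam (g \<otimes> (?h \<otimes> x \<otimes> y \<otimes> ?h))"
      using y g_Units by (simp flip: m_assoc)
    also have "\<dots> = lam ((?h \<otimes> x \<otimes> y \<otimes> ?h) \<otimes> g)"
      using lam_mult_g[of "?h \<otimes> x \<otimes> y \<otimes> ?h"] y by simp
    also have "(?h \<otimes> x \<otimes> y \<otimes> ?h) \<otimes> g = ?h \<otimes> x \<otimes> y"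
      using y g_Units by (simp add: m_assoc)
    finally show ?thesis
      using y by (simp add: antipode_x smul_minus_one k_functional_smul[OF lam_linear])
  qed
  have "lam (z \<otimes> S (x \<otimes> w)) = lam ((z \<otimes> S w) \<otimes> S x)"
    using x by (simp add: antipode_mult m_assoc)
  also have "\<dots> = lam ((S x \<otimes> z) \<otimes> S w)"
    using x comm_x[of "z \<otimes> S w"] by (simp add: m_assoc)
  also have "\<dots> = lam (S (x \<otimes> w) \<otimes> z)"
    using x x.IH[of "S x \<otimes> z"] by (simp add: antipode_mult m_assoc)
  finally show ?case .
qed (simp_all add: l_distr r_distr k_endo_simps[OF k_endo_antipode] k_functional_add[OF lam_linear]
    k_functional_smul[OF lam_linear])

text \<open>On \<open>x\<close> this is \<open>S\<^sup>2(x) = g\<^sup>-\<^sup>1 x g = q\<^sup>-\<^sup>1 x\<close>, which cancels the factor in \<open>\<lambda>(z x) = q \<lambda>(x z)\<close>.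
  For \<open>g\<close>, which \<open>S\<^sup>2\<close> fixes, the identity would fail by the factor \<open>q\<close>; hence the restriction to \<open>R\<close>.\<close>

lemma lam_antipode_square_R:
  assumes "a \<in> R" "z \<in> carrier A"
  shows "lam (a \<otimes> z) = lam (z \<otimes> S (S a))"
  using assms
proof (induction arbitrary: z rule: R_induct)
  case zero
  then show ?case using k_endo_zero[OF k_endo_antipode] by simp
next
  case one
  then show ?case by (simp add: antipode_one)
next
  case (x w)
  have comm_x: "lam (x \<otimes> y) = lam (y \<otimes> S (S x))" if y: "y \<in> carrier A" for y
  proof -
    have S_inv_g: "S (inv g) = g"
      using antipode_Units(2)[OF g_Units] g_Units by (simp add: antipode_g)
    have "S (S x) = inv g \<otimes> (x \<otimes> g)"
      using S_inv_g
      by (simp add: antipode_x smul_minus_one k_endo_smul[OF k_endo_antipode] antipode_mult m_assoc)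
    moreover have "q \<star> (inv g \<otimes> (x \<otimes> g)) = x"
    proof -
      have "q \<star> (inv g \<otimes> (x \<otimes> g)) = inv g \<otimes> (g \<otimes> x)"
        by (simp add: g_x)
      then show ?thesis
        using g_Units by (simp flip: m_assoc)
    qed
    ultimately have "q \<star> S (S x) = x" by simp
    then have "q \<star> (y \<otimes> S (S x)) = y \<otimes> x"
      using y by (simp flip: smul_mult_right)
    then have "q * lam (y \<otimes> S (S x)) = lam (y \<otimes> x)"
      using y by (simp flip: k_functional_smul[OF lam_linear])
    then show ?thesis
      using lam_mult_x[OF y] by simp
  qed
  have "lam ((x \<otimes> w) \<otimes> z) = lam (w \<otimes> (z \<otimes> S (S x)))"
    using x comm_x[of "w \<otimes> z"] by (simp add: m_assoc)
  also have "\<dots> = lam (z \<otimes> S (S (x \<otimes> w)))"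
    using x x.IH[of "z \<otimes> S (S x)"] by (simp add: antipode_mult m_assoc)
  finally show ?case .
qed (simp_all add: l_distr r_distr k_endo_simps[OF k_endo_antipode] k_functional_add[OF lam_linear]
    k_functional_smul[OF lam_linear])

definition form :: "'a \<Rightarrow> 'a \<Rightarrow> 'k" where
  "form y z = lam (z \<otimes> S y)"

lemma form_taft_pairing: "taft_pairing form"
  unfolding taft_pairing_def
proof (intro conjI ballI allI)
  show "k_functional (form u)" if "u \<in> carrier A" for u
    using that by (simp add: k_functional_def form_def l_distr k_functional_add[OF lam_linear]
      k_functional_smul[OF lam_linear])
  show "k_functional (\<lambda>u. form u v)" if "v \<in> carrier A" for v
    using that by (simp add: k_functional_def form_def r_distr k_functional_add[OF lam_linear]
      k_functional_smul[OF lam_linear] k_endo_simps[OF k_endo_antipode])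
  fix s t and i j :: nat
  define u where "u = - s - int i"
  obtain c where c: "c \<noteq> 0" "S (e s \<otimes> x [^] i) = c \<star> (e u \<otimes> x [^] i)"
    using antipode_basis[of s i] by (auto simp: u_def)
  have "x [^] j \<otimes> e u = e (u - int j) \<otimes> x [^] j"
    by (simp add: e_x_pow)
  then have "(e t \<otimes> x [^] j) \<otimes> (e u \<otimes> x [^] i) = (e t \<otimes> e (u - int j)) \<otimes> (x [^] j \<otimes> x [^] i)"
    by (simp add: m_assoc) (simp flip: m_assoc)
  then have "form (e s \<otimes> x [^] i) (e t \<otimes> x [^] j) =
      c * lam ((e t \<otimes> e (u - int j)) \<otimes> x [^] (i + j))"
    by (simp add: form_def c(2) k_functional_smul[OF lam_linear] nat_pow_mult add.commute)
  moreover have "[t = u - int j] (mod int N) \<longleftrightarrow> [s + t = 1] (mod int N)" if "i + j = N - 1"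
  proof -
    \<comment> \<open>Modulo \<open>N\<close> the exponent \<open>i + j = N - 1\<close> counts as \<open>-1\<close>, which is the source of the index \<open>1 - s\<close>.\<close>
    have "t - (u - int j) = (s + t - 1) + int N"
      using that N_ge_2 by (simp add: u_def)
    then show ?thesis
      by (simp only: cong_iff_dvd_diff dvd_add_triv_right_iff)
  qed
  ultimately show "form (e s \<otimes> x [^] i) (e t \<otimes> x [^] j) \<noteq> 0 \<longleftrightarrow>
      i + j = N - 1 \<and> [s + t = 1] (mod int N)"
    using c(1) k_functional_zero[OF lam_linear]
    by (cases "i + j = N - 1") (auto simp: e_e lam_basis)
qed

lemma form_mult_left:
  assumes "a \<in> R" "y \<in> carrier A" "z \<in> carrier A"
  shows "form (a \<otimes> y) z = form y (S a \<otimes> z)"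
  using assms lam_antipode_R[of a "z \<otimes> S y"] by (simp add: form_def antipode_mult m_assoc)

lemma form_mult_right:
  assumes "a \<in> R" "y \<in> carrier A" "z \<in> carrier A"
  shows "form z (a \<otimes> y) = form (S a \<otimes> z) y"
  using assms lam_antipode_square_R[of a "y \<otimes> S z"] by (simp add: form_def antipode_mult m_assoc)

lemma right_orth_M:
  "m \<le> N \<Longrightarrow> right_orth A form (M s m) = {y \<in> carrier A. e (1 - s) \<otimes> y \<in> M (1 - s) (N - m)}"
  by (rule taft_pairing_right_orth[OF form_taft_pairing])

lemma left_orth_M:
  "m \<le> N \<Longrightarrow> left_orth A form (M s m) = right_orth A form (M s m)"
  unfolding left_orth_eq_right_orth_flip
  by (simp add: taft_pairing_right_orth form_taft_pairing taft_pairing_flip)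

lemma right_orth_l_coset_M:
  assumes "a \<in> R" "a \<in> Units A"
  shows "right_orth A form (a <# M s m) = S (inv a) <# right_orth A form (M s m)"
  using right_orth_l_coset[OF antipode_Units(1)[OF assms(2)] M_subset, of s m form a]
    form_mult_left[OF assms(1)] M_subset[of s m] antipode_Units(2)[OF assms(2)] by auto

lemma left_orth_l_coset_M:
  assumes "a \<in> R" "a \<in> Units A"
  shows "left_orth A form (a <# M s m) = S (inv a) <# left_orth A form (M s m)"
  unfolding left_orth_eq_right_orth_flip
  using right_orth_l_coset[OF antipode_Units(1)[OF assms(2)] M_subset, of s m "\<lambda>y z. form z y" a]
    form_mult_right[OF assms(1)] M_subset[of s m] antipode_Units(2)[OF assms(2)] by auto

end

section \<open>The quotient of the free algebra as an instance\<close>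

lemma taft_class_closed: "taft_class N q f \<in> carrier (taft_algebra N q)"
  and taft_class_mult:
    "taft_class N q (f * f') = taft_class N q f \<otimes>\<^bsub>taft_algebra N q\<^esub> taft_class N q f'"
  and taft_class_add:
    "taft_class N q (f + f') = taft_class N q f \<oplus>\<^bsub>taft_algebra N q\<^esub> taft_class N q f'"
  and taft_class_one: "taft_class N q 1 = \<one>\<^bsub>taft_algebra N q\<^esub>"
  using taft_class_hom[of N q] by (auto simp: ring_hom_def ring_of_type_algebra_def)

lemma taft_class_zero: "f \<in> taft_ideal N q \<Longrightarrow> taft_class N q f = \<zero>\<^bsub>taft_algebra N q\<^esub>"
  using ideal.axioms(2) ideal_taft_ideal[of N q]
  by (simp add: taft_class_def taft_algebra_def FactRing_def abelian_subgroup.a_rcos_const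
      ideal.axioms(1) additive_subgroup_def abelian_subgroupI3 ideal_def ring_def)

lemma taft_class_power: "taft_class N q (f ^ n) = taft_class N q f [^]\<^bsub>taft_algebra N q\<^esub> n"
  for n :: nat
proof -
  interpret ring "taft_algebra N q" by (rule taft_ring)
  show ?thesis
    by (induction n)
      (simp_all add: taft_class_one taft_class_mult taft_class_closed power_Suc2 del: power_Suc)
qed

lemma taft_ideal_generators:
  "free_g ^ N - 1 \<in> taft_ideal N q" "free_x ^ N \<in> taft_ideal N q"
  "free_g * free_x - free_const q * free_x * free_g \<in> taft_ideal N q"
  using ring.genideal_self[OF ring_ring_of_type, of "{free_g ^ N - 1, free_x ^ N,
    free_g * free_x - free_const q * free_x * free_g}"]
  by (auto simp: taft_ideal_def ring_of_type_algebra_def)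

lemma taft_class_eqI:
  assumes "f - f' \<in> taft_ideal N q"
  shows "taft_class N q f = taft_class N q f'"
proof -
  interpret ring "taft_algebra N q" by (rule taft_ring)
  have "taft_class N q ((f - f') + f') = taft_class N q f'"
    unfolding taft_class_add taft_class_zero[OF assms] by (simp add: taft_class_closed)
  then show ?thesis by simp
qed

text \<open>Every element is the class of a combination of words, and a word is built from the empty word by
  left multiplication with letters.\<close>

lemma taft_algebra_generation:
  assumes W: "k_algebra.k_subspace (taft_algebra N q) (taft_unit N q) W"
    and one: "\<one>\<^bsub>taft_algebra N q\<^esub> \<in> W"
    and g: "\<And>w. w \<in> W \<Longrightarrow> taft_g N q \<otimes>\<^bsub>taft_algebra N q\<^esub> w \<in> W"
    and x: "\<And>w. w \<in> W \<Longrightarrow> taft_x N q \<otimes>\<^bsub>taft_algebra N q\<^esub> w \<in> W"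
  shows "carrier (taft_algebra N q) \<subseteq> W"
proof
  interpret k_algebra "taft_algebra N q" "taft_unit N q" by (rule taft_k_algebra)
  fix y assume "y \<in> carrier (taft_algebra N q)"
  then obtain f where y: "y = taft_class N q f"
    by (auto simp: taft_algebra_def FactRing_def A_RCOSETS_def' taft_class_def)
  have word: "taft_class N q (Poly_Mapping.single w 1) \<in> W" for w
  proof (induction w)
    case Nil
    then show ?case using one taft_class_one[of N q] by (simp flip: single_one zero_list_def)
  next
    case (Cons c w)
    have "Poly_Mapping.single (c # w) 1 =
        (Poly_Mapping.single [c] 1 * Poly_Mapping.single w 1 :: 'a free_alg)"
      by (simp add: Poly_Mapping.mult_single plus_list_def)
    then show ?case
      using Cons g x by (cases c) (simp_all add: taft_class_mult taft_g_def taft_x_def free_g_def free_x_def)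
  qed
  have "taft_class N q f \<in> W"
  proof (induction f rule: update_induct)
    case const
    have "taft_class N q 0 = \<zero>\<^bsub>taft_algebra N q\<^esub>"
      using taft_class_add[of N q 0 0] taft_class_closed[of N q 0] by (simp add: add.r_cancel_one')
    then show ?case using W by (simp add: k_subspace_def)
  next
    case (update f w c)
    have "Poly_Mapping.update w c f = f + free_const c * Poly_Mapping.single w 1"
      using update.hyps
      by (intro poly_mapping_eqI)
        (auto simp: free_const_def Poly_Mapping.mult_single plus_list_def lookup_add lookup_single
          lookup_update when_def in_keys_iff)
    then show ?case
      using W word[of w] update.IH
      by (simp add: taft_class_add taft_class_mult k_subspace_def smul_def taft_unit_def)
  qed
  then show "y \<in> W" by (simp add: y)
qed

lemma taft_algebra_presentation:
  assumes "N \<ge> 2" and "primitive_root_of_unity N q"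
  shows "taft_presentation (taft_algebra N q) (taft_unit N q) (taft_g N q) (taft_x N q) q N"
proof -
  interpret k_algebra "taft_algebra N q" "taft_unit N q" by (rule taft_k_algebra)
  show ?thesis
  proof (unfold_locales, goal_cases)
    case 5
    show ?case
      using taft_class_eqI[OF taft_ideal_generators(1)]
      by (simp add: taft_g_def taft_class_one flip: taft_class_power)
  next
    case 6
    show ?case
      using taft_class_zero[OF taft_ideal_generators(2)]
      by (simp add: taft_x_def flip: taft_class_power)
  next
    case 7
    have "taft_class N q (free_g * free_x) = taft_class N q (free_const q * (free_x * free_g))"
      using taft_class_eqI[OF taft_ideal_generators(3)] by (simp add: mult.assoc)
    then show ?case
      by (simp add: taft_class_mult taft_g_def taft_x_def taft_unit_def smul_def)
  next
    case 8
    then show ?case by (intro taft_algebra_generation) auto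
  qed (use assms in \<open>simp_all add: taft_g_def taft_x_def taft_class_closed\<close>)
qed

section \<open>Orthogonals in the Taft algebra\<close>

theorem theorem29:
  fixes N m :: nat and s :: int and q :: "'k::field"
    and \<Delta> :: "'k free_alg set \<Rightarrow> (('k free_alg set \<Rightarrow> 'k free_alg set \<Rightarrow> 'k free_alg set) \<Rightarrow> 'k free_alg set)"
    and \<epsilon> lam :: "'k free_alg set \<Rightarrow> 'k"
    and S :: "'k free_alg set \<Rightarrow> 'k free_alg set"
    and a :: "'k free_alg set"
  assumes "N \<ge> 2"
    and "primitive_root_of_unity N q"
    and "taft_hopf N q \<Delta> \<epsilon> S"
    and "taft_integral N q lam"
    and "a \<in> taft_R N q" and "a \<in> Units (taft_algebra N q)"
    and "0 \<le> s" and "s \<le> int N - 1" and "m \<le> N - 1"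
  shows "let A = taft_algebra N q; B = taft_form N q S lam in
      left_orth A B (taft_N N q s m) = right_orth A B (taft_N N q s m)
    \<and> left_orth A B (a <#\<^bsub>A\<^esub> taft_N N q s m) = right_orth A B (a <#\<^bsub>A\<^esub> taft_N N q s m)
    \<and> is_direct_sum A (right_orth A B (taft_N N q s 0))
        {t. 0 \<le> t \<and> t \<le> int N - 1 \<and> \<not> [t = 1 - s] (mod int N)} (\<lambda>t. taft_N N q t 0)
    \<and> is_direct_sum2 A (right_orth A B (taft_N N q s m))
        (right_orth A B (taft_N N q s 0)) (taft_N N q (1 - s) (N - m))
    \<and> right_orth A B (a <#\<^bsub>A\<^esub> taft_N N q s m)
        = S (inv\<^bsub>A\<^esub> a) <#\<^bsub>A\<^esub> right_orth A B (taft_N N q s m)"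
proof -
  let ?A = "taft_algebra N q"
  interpret P: taft_presentation ?A "taft_unit N q" "taft_g N q" "taft_x N q" q N
    by (rule taft_algebra_presentation[OF assms(1,2)])
  have hopf: "hopf_algebra ?A (taft_unit N q) \<Delta> \<epsilon> S"
    using assms(3) by (simp add: taft_hopf_def Let_def)
  interpret H: hopf_algebra ?A "taft_unit N q" \<Delta> \<epsilon> S by (rule hopf)
  interpret T: taft_hopf_presentation ?A "taft_unit N q" "taft_g N q" "taft_x N q" q N \<Delta> \<epsilon> S lam
  proof (unfold_locales, goal_cases)
    case 5
    then show ?case
      using assms(4) by (simp add: taft_integral_def P.k_functional_def P.smul_def Let_def)
  next
    case (6 m b)
    have "lam (taft_x N q [^]\<^bsub>?A\<^esub> m \<otimes>\<^bsub>?A\<^esub> taft_g N q [^]\<^bsub>?A\<^esub> int b) =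
        (if m = N - 1 \<and> [int b = 1] (mod int N) then 1 else 0)"
      using assms(4) by (simp add: taft_integral_def Let_def)
    then show ?case
      using cong_int_iff[of b 1 N] by (simp add: int_pow_int)
  qed (use assms(3) in \<open>simp_all add: taft_hopf_def Let_def\<close>)
  have e: "taft_e N q = P.e"
    using assms(1)
    by (simp add: fun_eq_iff taft_e_def P.e_def P.smul_def atLeast0AtMost lessThan_Suc_atMost[symmetric])
  have R: "taft_R N q = P.R"
    by (simp add: taft_R_def P.R_def)
  have M: "taft_N N q = P.M"
    by (simp add: fun_eq_iff taft_N_def P.M_def e R)
  have B: "taft_form N q S lam = T.form"
    by (simp add: fun_eq_iff taft_form_def T.form_def)
  have m: "m \<le> N" using assms(9) by simp
  have orth0: "right_orth ?A T.form (P.M s 0) =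
      {y \<in> carrier ?A. P.e (1 - s) \<otimes>\<^bsub>?A\<^esub> y = \<zero>\<^bsub>?A\<^esub>}"
    using T.right_orth_M[of 0 s] by (simp add: P.M_N)
  have a: "a \<in> P.R" using assms(5) R by simp
  show ?thesis
    unfolding Let_def M B
    using T.left_orth_M[OF m, of s] T.right_orth_l_coset_M[OF a assms(6), of s m]
      T.left_orth_l_coset_M[OF a assms(6), of s m] P.annihilator_direct_sum[of "1 - s"]
      P.preimage_direct_sum2[of "1 - s" "N - m"] T.right_orth_M[OF m, of s]
    by (simp add: orth0)
qed

end
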